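(* Let $\Omega$ be a bounded domain in $\mathbb{C}^n$, let $\mathcal{E}$ and $\mathcal{E}_*$ be two Hilbert spaces, let $\mathcal{H}_g$ be a good reproducing kernel Hilbert module on $\Omega$ (with scalar good kernel $g$), and let $\mathcal{H}_K\subseteq\mathcal{O}(\Omega,\mathcal{E})$ be a reproducing kernel Hilbert module over $\mathbb{C}[\boldsymbol{z}]$ with $\mathcal{B}(\mathcal{E})$-valued kernel $K$. Then the following conditions are equivalent: (1) $\mathcal{H}_K$ dilates to $\mathcal{H}_g\otimes\mathcal{E}_*$. (2) There exists a holomorphic function $\Phi:\Omega\to\mathcal{B}(\mathcal{E}_*,\mathcal{E})$ such that $$K(\boldsymbol{z},\boldsymbol{w})=g(\boldsymbol{z},\boldsymbol{w})\,\Phi(\boldsymbol{z})\Phi(\boldsymbol{w})^*\qquad(\boldsymbol{z},\boldsymbol{w}\in\Omega).$$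
   Context: All Hilbert spaces are complex. A $\mathcal{B}(\mathcal{E})$-valued kernel on $\Omega$ is a function $K:\Omega\times\Omega\to\mathcal{B}(\mathcal{E})$ with $\sum_{p,q=1}^m\langle K(x_p,x_q)\eta_q,\eta_p\rangle\ge 0$ for all $m\in\mathbb{N}$, $x_j\in\Omega$, $\eta_j\in\mathcal{E}$; $\mathcal{H}_K$ is the associated reproducing kernel Hilbert space of $\mathcal{E}$-valued functions, in which the functions $K(\cdot,\boldsymbol{w})\eta$ are total and $\langle f(\boldsymbol{w}),\eta\rangle_{\mathcal{E}}=\langle f,K(\cdot,\boldsymbol{w})\eta\rangle_{\mathcal{H}_K}$. Scalar kernels are the case $\mathcal{E}=\mathbb{C}$. Standing assumptions: kernels $K(\boldsymbol{z},\boldsymbol{w})$ on $\Omega$ are holomorphic in $\boldsymbol{z}=(z_1,\dots,z_n)$ and anti-holomorphic in $\boldsymbol{w}$, so that $\mathcal{H}_K\subseteq\mathcal{O}(\Omega,\mathcal{E})$ (holomorphic $\mathcal{E}$-valued functions), and $K(\cdot,\boldsymbol{w})\ne0$ for all $\boldsymbol{w}\in\Omega$. $\mathcal{H}_K$ is a reproducing kernel Hilbert module (over $\mathbb{C}[\boldsymbol{z}]$) if $z_j\mathcal{H}_K\subseteq\mathcal{H}_K$ for $j=1,\dots,n$; then $M_{z_j}$ denotes the bounded operator $(M_{z_j}f)(\boldsymbol{w})=w_jf(\boldsymbol{w})$ on $\mathcal{H}_K$. A scalar-valued kernel $g$ on $\Omega$ is a good kernel (and $\mathcal{H}_g$ is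 a good reproducing kernel Hilbert module) if $\mathcal{H}_g$ is a reproducing kernel Hilbert module, $\bigcap_{j=1}^n\ker(M_{z_j}^*-\bar w_jI_{\mathcal{H}_g})=\mathbb{C}\,g(\cdot,\boldsymbol{w})$ for all $\boldsymbol{w}\in\Omega$, and there exists $\boldsymbol{w}_0\in\Omega$ with $g(\cdot,\boldsymbol{w}_0)\equiv 1$. $\mathcal{H}_K$ dilates to $\mathcal{H}_g\otimes\mathcal{E}_*$ if there exists an isometry $\Pi:\mathcal{H}_K\to\mathcal{H}_g\otimes\mathcal{E}_*$ such that $(M_{z_i}^*\otimes I_{\mathcal{E}_*})\Pi=\Pi M_{z_i}^*$ for $i=1,\dots,n$. *)

theory Defs
  imports "HOL-Analysis.Analysis" "HOL-Library.Function_Algebras"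
begin

section \<open>Complex vector spaces and complex Hilbert spaces as types\<close>

class scaleC =
  fixes scaleC :: "complex \<Rightarrow> 'a \<Rightarrow> 'a" (infixr "*\<^sub>C" 75)

class complex_vector = scaleC + ab_group_add +
  assumes scaleC_add_right: "a *\<^sub>C (x + y) = a *\<^sub>C x + a *\<^sub>C y"
    and scaleC_add_left: "(a + b) *\<^sub>C x = a *\<^sub>C x + b *\<^sub>C x"
    and scaleC_scaleC: "a *\<^sub>C b *\<^sub>C x = (a * b) *\<^sub>C x"
    and scaleC_one: "1 *\<^sub>C x = x"

class complex_normed_vector = complex_vector + real_normed_vector +
  assumes scaleR_scaleC: "r *\<^sub>R x = complex_of_real r *\<^sub>C x"
    and norm_scaleC: "norm (a *\<^sub>C x) = cmod a * norm x"

text \<open>The inner product is linear in its first argument.\<close>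

class complex_inner = complex_normed_vector +
  fixes cinner :: "'a \<Rightarrow> 'a \<Rightarrow> complex"
  assumes cinner_commute: "cinner x y = cnj (cinner y x)"
    and cinner_add_left: "cinner (x + y) z = cinner x z + cinner y z"
    and cinner_scaleC_left: "cinner (a *\<^sub>C x) y = a * cinner x y"
    and cinner_self_nonneg: "cinner x x \<in> \<real>\<^sub>\<ge>\<^sub>0"
    and cinner_self_eq_0: "cinner x x = 0 \<longleftrightarrow> x = 0"
    and norm_eq_sqrt_cinner: "norm x = sqrt (Re (cinner x x))"

class chilbert_space = complex_inner + complete_space

lemma vector_space_scaleC:
  "vector_space (scaleC :: complex \<Rightarrow> 'a::complex_vector \<Rightarrow> 'a)"
  by unfold_locales (simp_all add: scaleC_add_right scaleC_add_left scaleC_scaleC scaleC_one)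

abbreviation cspan :: "'a::complex_vector set \<Rightarrow> 'a set"
  where "cspan \<equiv> module.span scaleC"

abbreviation csubspace :: "'a::complex_vector set \<Rightarrow> bool"
  where "csubspace \<equiv> module.subspace scaleC"

instantiation complex :: chilbert_space
begin
definition scaleC_complex :: "complex \<Rightarrow> complex \<Rightarrow> complex"
  where "scaleC_complex a x = a * x"
definition cinner_complex :: "complex \<Rightarrow> complex \<Rightarrow> complex"
  where "cinner_complex x y = x * cnj y"
instance
proof
  fix x :: complex
  show "cinner x x \<in> \<real>\<^sub>\<ge>\<^sub>0"
    by (simp add: cinner_complex_def complex_nonneg_Reals_iff)
  show "norm x = sqrt (Re (cinner x x))"
    by (simp add: cinner_complex_def cmod_def power2_eq_square)
qed (simp_all add: scaleC_complex_def cinner_complex_def algebra_simps scaleR_conv_of_real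
      norm_mult)
end

instantiation "fun" :: (type, complex_vector) complex_vector
begin
definition scaleC_fun :: "complex \<Rightarrow> ('a \<Rightarrow> 'b) \<Rightarrow> 'a \<Rightarrow> 'b"
  where "scaleC_fun a f = (\<lambda>x. a *\<^sub>C f x)"
instance
  by standard
    (simp_all add: scaleC_fun_def fun_eq_iff scaleC_add_right scaleC_add_left scaleC_scaleC
      scaleC_one)
end

section \<open>Bounded operators between Hilbert space types\<close>

lemma bounded_linear_scaleC:
  "bounded_linear (\<lambda>x::'a::complex_normed_vector. a *\<^sub>C x)"
  by (rule bounded_linear_intro[where K = "cmod a"])
    (simp_all add: scaleC_add_right scaleR_scaleC scaleC_scaleC norm_scaleC mult.commute)

instantiation blinfun :: (real_normed_vector, complex_normed_vector) complex_normed_vector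
begin
definition scaleC_blinfun :: "complex \<Rightarrow> 'a \<Rightarrow>\<^sub>L 'b \<Rightarrow> 'a \<Rightarrow>\<^sub>L 'b"
  where "scaleC_blinfun a A = Blinfun (\<lambda>x. a *\<^sub>C blinfun_apply A x)"

lemma scaleC_blinfun_apply:
  "blinfun_apply (a *\<^sub>C A) x = a *\<^sub>C blinfun_apply (A :: 'a \<Rightarrow>\<^sub>L 'b) x"
  unfolding scaleC_blinfun_def
  by (subst bounded_linear_Blinfun_apply)
    (auto intro: bounded_linear_compose[OF bounded_linear_scaleC] blinfun.bounded_linear_right)

instance
proof
  fix a b :: complex and r :: real and A B :: "'a \<Rightarrow>\<^sub>L 'b"
  show "a *\<^sub>C (A + B) = a *\<^sub>C A + a *\<^sub>C B" "(a + b) *\<^sub>C A = a *\<^sub>C A + b *\<^sub>C A"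
    "a *\<^sub>C b *\<^sub>C A = (a * b) *\<^sub>C A" "1 *\<^sub>C A = A" "r *\<^sub>R A = complex_of_real r *\<^sub>C A"
    by (rule blinfun_eqI, simp add: scaleC_blinfun_apply blinfun.add_left blinfun.scaleR_left
        scaleC_add_right scaleC_add_left scaleC_scaleC scaleC_one scaleR_scaleC)+
  have le: "norm (c *\<^sub>C C) \<le> cmod c * norm C" for c and C :: "'a \<Rightarrow>\<^sub>L 'b"
  proof (rule norm_blinfun_bound)
    fix x
    show "norm (blinfun_apply (c *\<^sub>C C) x) \<le> cmod c * norm C * norm x"
      using mult_left_mono[OF norm_blinfun[of C x], of "cmod c"]
      by (simp add: scaleC_blinfun_apply norm_scaleC mult.assoc)
  qed simp
  show "norm (a *\<^sub>C A) = cmod a * norm A"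
  proof (cases "a = 0")
    case True
    then show ?thesis using le[of a A] by simp
  next
    case False
    have "inverse a *\<^sub>C a *\<^sub>C A = A"
      using False
      by (intro blinfun_eqI) (simp add: scaleC_blinfun_apply scaleC_scaleC scaleC_one)
    then have "norm A \<le> cmod (inverse a) * norm (a *\<^sub>C A)"
      using le[of "inverse a" "a *\<^sub>C A"] by simp
    then have "cmod a * norm A \<le> norm (a *\<^sub>C A)"
      using False by (simp add: norm_inverse norm_divide field_simps)
    then show ?thesis using le[of a A] by simp
  qed
qed
end

text \<open>The library type of bounded operators consists of the real-linear ones; the space
  \<open>B(E, F)\<close> of complex-linear bounded operators is the following (closed) subspace.\<close>

definition complex_ops :: "('a::complex_normed_vector \<Rightarrow>\<^sub>L 'b::complex_normed_vector) set"
  where "complex_ops = {A. \<forall>c x. blinfun_apply A (c *\<^sub>C x) = c *\<^sub>C blinfun_apply A x}"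

section \<open>Complex Hilbert spaces with explicit carrier\<close>

text \<open>The vector space operations are those of the ambient type. For a space of functions on
  \<open>\<Omega>\<close> they are pointwise; such functions are represented by total functions that vanish
  outside \<open>\<Omega>\<close>.\<close>

record 'a hspace =
  hcarrier :: "'a set"
  hinner :: "'a \<Rightarrow> 'a \<Rightarrow> complex"

definition hnorm :: "('a::complex_vector, 'm) hspace_scheme \<Rightarrow> 'a \<Rightarrow> real"
  where "hnorm H x = sqrt (Re (hinner H x x))"

locale pre_hilbert =
  fixes H :: "'a::complex_vector hspace"
  assumes subspace: "csubspace (hcarrier H)"
    and inner_commute: "\<lbrakk>x \<in> hcarrier H; y \<in> hcarrier H\<rbrakk> \<Longrightarrow> hinner H x y = cnj (hinner H y x)"
    and inner_add_left: "\<lbrakk>x \<in> hcarrier H; y \<in> hcarrier H; z \<in> hcarrier H\<rbrakk>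
      \<Longrightarrow> hinner H (x + y) z = hinner H x z + hinner H y z"
    and inner_scaleC_left: "\<lbrakk>x \<in> hcarrier H; y \<in> hcarrier H\<rbrakk>
      \<Longrightarrow> hinner H (a *\<^sub>C x) y = a * hinner H x y"
    and inner_self_nonneg: "x \<in> hcarrier H \<Longrightarrow> hinner H x x \<in> \<real>\<^sub>\<ge>\<^sub>0"
    and inner_self_eq_0: "\<lbrakk>x \<in> hcarrier H; hinner H x x = 0\<rbrakk> \<Longrightarrow> x = 0"

text \<open>The distance is cut off outside the carrier because \<^locale>\<open>Metric_space\<close> requires
  symmetry and nonnegativity on the whole type.\<close>

definition hdist :: "'a::complex_vector hspace \<Rightarrow> 'a \<Rightarrow> 'a \<Rightarrow> real"
  where "hdist H x y = (if x \<in> hcarrier H \<and> y \<in> hcarrier H then hnorm H (x - y) else 0)"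

context pre_hilbert
begin

lemma carrier_zero: "0 \<in> hcarrier H"
  and carrier_add: "x \<in> hcarrier H \<Longrightarrow> y \<in> hcarrier H \<Longrightarrow> x + y \<in> hcarrier H"
  and carrier_scaleC: "x \<in> hcarrier H \<Longrightarrow> a *\<^sub>C x \<in> hcarrier H"
  and carrier_diff: "x \<in> hcarrier H \<Longrightarrow> y \<in> hcarrier H \<Longrightarrow> x - y \<in> hcarrier H"
proof -
  interpret V: vector_space "scaleC :: complex \<Rightarrow> 'a \<Rightarrow> 'a" by (rule vector_space_scaleC)
  show "0 \<in> hcarrier H" by (rule V.subspace_0[OF subspace])
  show "x \<in> hcarrier H \<Longrightarrow> y \<in> hcarrier H \<Longrightarrow> x + y \<in> hcarrier H"
    by (rule V.subspace_add[OF subspace])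
  show "x \<in> hcarrier H \<Longrightarrow> a *\<^sub>C x \<in> hcarrier H" by (rule V.subspace_scale[OF subspace])
  show "x \<in> hcarrier H \<Longrightarrow> y \<in> hcarrier H \<Longrightarrow> x - y \<in> hcarrier H"
    by (rule V.subspace_diff[OF subspace])
qed

lemma inner_add_right:
  "\<lbrakk>x \<in> hcarrier H; y \<in> hcarrier H; z \<in> hcarrier H\<rbrakk> \<Longrightarrow> hinner H z (x + y) = hinner H z x + hinner H z y"
  by (metis carrier_add complex_cnj_add inner_add_left inner_commute)

lemma inner_scaleC_right:
  "\<lbrakk>x \<in> hcarrier H; y \<in> hcarrier H\<rbrakk> \<Longrightarrow> hinner H y (a *\<^sub>C x) = cnj a * hinner H y x"
  by (metis carrier_scaleC complex_cnj_mult inner_scaleC_left inner_commute)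

lemma inner_self: "x \<in> hcarrier H \<Longrightarrow> hinner H x x = complex_of_real ((hnorm H x)\<^sup>2)"
  using inner_self_nonneg[of x] by (simp add: hnorm_def complex_nonneg_Reals_iff complex_eq_iff)

lemma hnorm_nonneg: "x \<in> hcarrier H \<Longrightarrow> 0 \<le> hnorm H x"
  using inner_self_nonneg[of x] by (simp add: hnorm_def complex_nonneg_Reals_iff)

lemma inner_zero_left: "y \<in> hcarrier H \<Longrightarrow> hinner H 0 y = 0"
  using inner_add_left[of 0 0 y] carrier_zero by simp

lemma hnorm_eq_0: "x \<in> hcarrier H \<Longrightarrow> hnorm H x = 0 \<longleftrightarrow> x = 0"
  using inner_self[of x] inner_self_eq_0[of x] inner_zero_left[OF carrier_zero] by auto

lemma hnorm_add_sq:
  assumes "x \<in> hcarrier H" "y \<in> hcarrier H"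
  shows "(hnorm H (x + a *\<^sub>C y))\<^sup>2
    = (hnorm H x)\<^sup>2 + 2 * Re (cnj a * hinner H x y) + (cmod a)\<^sup>2 * (hnorm H y)\<^sup>2"
proof -
  have c: "a *\<^sub>C y \<in> hcarrier H" using assms carrier_scaleC by simp
  have "hinner H (x + a *\<^sub>C y) (x + a *\<^sub>C y)
      = hinner H x x + (cnj a * hinner H x y + cnj (cnj a * hinner H x y))
        + a * cnj a * hinner H y y"
    using assms c carrier_add
    by (simp add: inner_add_left inner_add_right inner_scaleC_left
        inner_scaleC_right inner_commute[of y x] algebra_simps)
  then have "complex_of_real ((hnorm H (x + a *\<^sub>C y))\<^sup>2)
      = complex_of_real ((hnorm H x)\<^sup>2) + (cnj a * hinner H x y + cnj (cnj a * hinner H x y))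
        + a * cnj a * complex_of_real ((hnorm H y)\<^sup>2)"
    using assms c carrier_add by (simp only: inner_self)
  also have "\<dots> = complex_of_real ((hnorm H x)\<^sup>2 + 2 * Re (cnj a * hinner H x y)
      + (cmod a)\<^sup>2 * (hnorm H y)\<^sup>2)"
    by (simp only: complex_add_cnj complex_norm_square of_real_add of_real_mult)
  finally show ?thesis using of_real_eq_iff by blast
qed

lemma cauchy_schwarz:
  assumes "x \<in> hcarrier H" "y \<in> hcarrier H"
  shows "cmod (hinner H x y) \<le> hnorm H x * hnorm H y"
proof (cases "y = 0")
  case True
  then show ?thesis
    using assms inner_commute[of x 0] inner_zero_left[of x] carrier_zero hnorm_nonneg by simp
next
  case False
  define n where "n = (hnorm H y)\<^sup>2"
  define h where "h = hinner H x y"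
  define a where "a = - h / complex_of_real n"
  have n: "n > 0"
    using False hnorm_eq_0[OF assms(2)] by (simp add: n_def)
  have "cnj a * h = complex_of_real (- ((cmod h)\<^sup>2 / n))"
    by (simp add: a_def complex_norm_square[symmetric] mult.commute)
  moreover have "(cmod a)\<^sup>2 * n = (cmod h)\<^sup>2 / n"
    using n by (simp add: a_def norm_divide power_divide power2_eq_square)
  moreover have "0 \<le> (hnorm H (x + a *\<^sub>C y))\<^sup>2" by simp
  ultimately have "(cmod h)\<^sup>2 / n \<le> (hnorm H x)\<^sup>2"
    using hnorm_add_sq[OF assms, of a] by (simp add: n_def[symmetric] h_def[symmetric])
  then have "(cmod h)\<^sup>2 \<le> (hnorm H x * hnorm H y)\<^sup>2"
    using n by (simp add: pos_divide_le_eq n_def power_mult_distrib)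
  then show ?thesis
    using power2_le_imp_le assms hnorm_nonneg by (simp add: h_def)
qed

lemma hnorm_triangle:
  assumes "x \<in> hcarrier H" "y \<in> hcarrier H"
  shows "hnorm H (x + y) \<le> hnorm H x + hnorm H y"
proof (rule power2_le_imp_le)
  have "Re (hinner H x y) \<le> hnorm H x * hnorm H y"
    using cauchy_schwarz[OF assms] complex_Re_le_cmod order_trans by blast
  then show "(hnorm H (x + y))\<^sup>2 \<le> (hnorm H x + hnorm H y)\<^sup>2"
    using hnorm_add_sq[OF assms, of 1] by (simp add: scaleC_one power2_sum)
qed (use assms hnorm_nonneg in simp)

lemma hnorm_minus_commute:
  assumes "x \<in> hcarrier H" "y \<in> hcarrier H"
  shows "hnorm H (x - y) = hnorm H (y - x)"
proof -
  have d: "y - x \<in> hcarrier H" using assms carrier_diff by simp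
  have "(0::'a) + (- 1) *\<^sub>C (y - x) = x - y"
  proof -
    interpret V: vector_space "scaleC :: complex \<Rightarrow> 'a \<Rightarrow> 'a" by (rule vector_space_scaleC)
    show ?thesis by (simp add: V.scale_minus_left scaleC_one)
  qed
  then have "(hnorm H (x - y))\<^sup>2 = (hnorm H (y - x))\<^sup>2"
    using hnorm_add_sq[OF carrier_zero d, of "- 1"] inner_zero_left[OF d] hnorm_eq_0[OF carrier_zero]
    by simp
  then show ?thesis
    using power2_eq_iff_nonneg hnorm_nonneg carrier_diff assms by metis
qed

lemma metric_space: "Metric_space (hcarrier H) (hdist H)"
proof
  fix x y z
  show "0 \<le> hdist H x y" by (simp add: hdist_def hnorm_nonneg carrier_diff)
  show "hdist H x y = hdist H y x" by (simp add: hdist_def hnorm_minus_commute)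
  show "hdist H x y = 0 \<longleftrightarrow> x = y" if "x \<in> hcarrier H" "y \<in> hcarrier H"
    using that by (simp add: hdist_def hnorm_eq_0 carrier_diff)
  show "hdist H x z \<le> hdist H x y + hdist H y z"
    if "x \<in> hcarrier H" "y \<in> hcarrier H" "z \<in> hcarrier H"
    using that hnorm_triangle[of "x - y" "y - z"] by (simp add: hdist_def carrier_diff)
qed

end

locale hilbert = pre_hilbert +
  assumes complete: "Metric_space.mcomplete (hcarrier H) (hdist H)"

definition type_hspace :: "'a::complex_inner hspace"
  where "type_hspace = \<lparr>hcarrier = UNIV, hinner = cinner\<rparr>"

lemma hilbert_type_hspace: "hilbert (type_hspace :: 'a::chilbert_space hspace)"
proof -
  interpret V: vector_space "scaleC :: complex \<Rightarrow> 'a \<Rightarrow> 'a" by (rule vector_space_scaleC)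
  have "pre_hilbert (type_hspace :: 'a hspace)"
    by unfold_locales
      (auto simp: type_hspace_def V.subspace_UNIV cinner_add_left cinner_scaleC_left
        cinner_self_nonneg cinner_self_eq_0 intro: cinner_commute)
  moreover have "hdist type_hspace = (dist :: 'a \<Rightarrow> 'a \<Rightarrow> real)"
    by (auto simp: fun_eq_iff hdist_def hnorm_def type_hspace_def dist_norm norm_eq_sqrt_cinner)
  then have "Metric_space.mcomplete (hcarrier (type_hspace :: 'a hspace)) (hdist type_hspace)"
    using complete_UNIV by (simp add: type_hspace_def mcomplete_iff_complete)
  ultimately show ?thesis by (simp add: hilbert_def hilbert_axioms_def)
qed

definition hdense_span :: "'a::complex_vector hspace \<Rightarrow> 'a set \<Rightarrow> bool"
  where "hdense_span H S \<longleftrightarrow> S \<subseteq> hcarrier H \<and>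
    (\<forall>x\<in>hcarrier H. \<forall>e>0. \<exists>y\<in>cspan S. hnorm H (x - y) < e)"

definition hlinear :: "'a::complex_vector hspace \<Rightarrow> 'b::complex_vector hspace \<Rightarrow> ('a \<Rightarrow> 'b) \<Rightarrow> bool"
  where "hlinear H1 H2 A \<longleftrightarrow>
    (\<forall>x\<in>hcarrier H1. A x \<in> hcarrier H2) \<and>
    (\<forall>x\<in>hcarrier H1. \<forall>y\<in>hcarrier H1. A (x + y) = A x + A y) \<and>
    (\<forall>c. \<forall>x\<in>hcarrier H1. A (c *\<^sub>C x) = c *\<^sub>C A x)"

definition hbounded :: "'a::complex_vector hspace \<Rightarrow> 'b::complex_vector hspace \<Rightarrow> ('a \<Rightarrow> 'b) \<Rightarrow> bool"
  where "hbounded H1 H2 A \<longleftrightarrow> hlinear H1 H2 A \<and>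
    (\<exists>C. \<forall>x\<in>hcarrier H1. hnorm H2 (A x) \<le> C * hnorm H1 x)"

definition hisometry :: "'a::complex_vector hspace \<Rightarrow> 'b::complex_vector hspace \<Rightarrow> ('a \<Rightarrow> 'b) \<Rightarrow> bool"
  where "hisometry H1 H2 V \<longleftrightarrow> hlinear H1 H2 V \<and>
    (\<forall>x\<in>hcarrier H1. hnorm H2 (V x) = hnorm H1 x)"

text \<open>The Hilbert space adjoint, meaningful for bounded operators from \<open>H1\<close> to \<open>H2\<close>.\<close>

definition hadj :: "'a::complex_vector hspace \<Rightarrow> 'b::complex_vector hspace \<Rightarrow> ('a \<Rightarrow> 'b) \<Rightarrow> 'b \<Rightarrow> 'a"
  where "hadj H1 H2 A y =
    (THE x. x \<in> hcarrier H1 \<and> (\<forall>u\<in>hcarrier H1. hinner H2 (A u) y = hinner H1 u x))"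

definition op_adj :: "('a::chilbert_space \<Rightarrow>\<^sub>L 'b::chilbert_space) \<Rightarrow> 'b \<Rightarrow>\<^sub>L 'a"
  where "op_adj A = Blinfun (hadj type_hspace type_hspace (blinfun_apply A))"

section \<open>Hilbert space tensor products\<close>

text \<open>\<open>T\<close> together with \<open>\<tau> x y\<close> as \<open>x \<otimes> y\<close> is a Hilbert space tensor product of \<open>H1\<close> and \<open>H2\<close>;
  this determines \<open>(T, \<tau>)\<close> up to a unique unitary map compatible with \<open>\<tau>\<close>.\<close>

locale hilbert_tensor =
  H1: hilbert H1 + H2: hilbert H2 + T: hilbert T
  for H1 :: "'a::complex_vector hspace" and H2 :: "'b::complex_vector hspace"
    and T :: "'t::complex_vector hspace" +
  fixes \<tau> :: "'a \<Rightarrow> 'b \<Rightarrow> 't"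
  assumes linear_left: "y \<in> hcarrier H2 \<Longrightarrow> hlinear H1 T (\<lambda>x. \<tau> x y)"
    and linear_right: "x \<in> hcarrier H1 \<Longrightarrow> hlinear H2 T (\<lambda>y. \<tau> x y)"
    and inner_tensor: "\<lbrakk>x \<in> hcarrier H1; y \<in> hcarrier H2; x' \<in> hcarrier H1; y' \<in> hcarrier H2\<rbrakk>
      \<Longrightarrow> hinner T (\<tau> x y) (\<tau> x' y') = hinner H1 x x' * hinner H2 y y'"
    and total: "hdense_span T {\<tau> x y | x y. x \<in> hcarrier H1 \<and> y \<in> hcarrier H2}"

text \<open>\<open>A \<otimes> B\<close> is the unique bounded operator on \<open>T\<close> that acts on elementary tensors as expected;
  the value \<open>0\<close> outside the carrier makes the total function unique.\<close>

definition tensor_op ::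
  "'a::complex_vector hspace \<Rightarrow> 'b::complex_vector hspace \<Rightarrow> 't::complex_vector hspace \<Rightarrow>
   ('a \<Rightarrow> 'b \<Rightarrow> 't) \<Rightarrow> ('a \<Rightarrow> 'a) \<Rightarrow> ('b \<Rightarrow> 'b) \<Rightarrow> 't \<Rightarrow> 't"
  where "tensor_op H1 H2 T \<tau> A B =
    (THE C. hbounded T T C \<and> (\<forall>t. t \<notin> hcarrier T \<longrightarrow> C t = 0) \<and>
      (\<forall>x\<in>hcarrier H1. \<forall>y\<in>hcarrier H2. C (\<tau> x y) = \<tau> (A x) (B y)))"

section \<open>Holomorphic maps in several variables\<close>

definition holo_on :: "(complex ^ 'n \<Rightarrow> 'b::complex_normed_vector) \<Rightarrow> (complex ^ 'n) set \<Rightarrow> bool"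
  where "holo_on f \<Omega> \<longleftrightarrow>
    (\<forall>z\<in>\<Omega>. \<exists>L. (f has_derivative L) (at z) \<and> (\<forall>c v. L (c *s v) = c *\<^sub>C L v))"

definition antiholo_on :: "(complex ^ 'n \<Rightarrow> 'b::complex_normed_vector) \<Rightarrow> (complex ^ 'n) set \<Rightarrow> bool"
  where "antiholo_on f \<Omega> \<longleftrightarrow>
    (\<forall>z\<in>\<Omega>. \<exists>L. (f has_derivative L) (at z) \<and> (\<forall>c v. L (c *s v) = cnj c *\<^sub>C L v))"

definition bounded_domain :: "(complex ^ 'n) set \<Rightarrow> bool"
  where "bounded_domain \<Omega> \<longleftrightarrow> open \<Omega> \<and> connected \<Omega> \<and> \<Omega> \<noteq> {} \<and> bounded \<Omega>"

section \<open>Kernels and reproducing kernel Hilbert modules\<close>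

text \<open>Only the values of a kernel on \<open>\<Omega> \<times> \<Omega>\<close> matter.\<close>

definition op_kernel ::
  "'z set \<Rightarrow> ('z \<Rightarrow> 'z \<Rightarrow> 'e::chilbert_space \<Rightarrow>\<^sub>L 'e) \<Rightarrow> bool"
  where "op_kernel \<Omega> K \<longleftrightarrow>
    (\<forall>z\<in>\<Omega>. \<forall>w\<in>\<Omega>. K z w \<in> complex_ops) \<and>
    (\<forall>(m::nat) x \<eta>. (\<forall>j<m. x j \<in> \<Omega>) \<longrightarrow>
      (\<Sum>p<m. \<Sum>q<m. cinner (blinfun_apply (K (x p) (x q)) (\<eta> q)) (\<eta> p)) \<in> \<real>\<^sub>\<ge>\<^sub>0)"

definition holo_kernel ::
  "(complex ^ 'n) set \<Rightarrow> (complex ^ 'n \<Rightarrow> complex ^ 'n \<Rightarrow> 'e::chilbert_space \<Rightarrow>\<^sub>L 'e) \<Rightarrow> bool"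
  where "holo_kernel \<Omega> K \<longleftrightarrow> op_kernel \<Omega> K \<and>
    (\<forall>w\<in>\<Omega>. holo_on (\<lambda>z. K z w) \<Omega>) \<and>
    (\<forall>z\<in>\<Omega>. antiholo_on (\<lambda>w. K z w) \<Omega>) \<and>
    (\<forall>w\<in>\<Omega>. \<exists>z\<in>\<Omega>. K z w \<noteq> 0)"

definition kernel_fun ::
  "'z set \<Rightarrow> ('z \<Rightarrow> 'z \<Rightarrow> 'e::chilbert_space \<Rightarrow>\<^sub>L 'e) \<Rightarrow> 'z \<Rightarrow> 'e \<Rightarrow> 'z \<Rightarrow> 'e"
  where "kernel_fun \<Omega> K w \<eta> = (\<lambda>z. if z \<in> \<Omega> then blinfun_apply (K z w) \<eta> else 0)"

text \<open>\<open>H\<close> is the reproducing kernel Hilbert space of \<open>K\<close>; it is determined by \<open>K\<close> on \<open>\<Omega>\<close>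
  up to the values of the inner product outside the carrier.\<close>

definition rkhs ::
  "'z set \<Rightarrow> ('z \<Rightarrow> 'z \<Rightarrow> 'e::chilbert_space \<Rightarrow>\<^sub>L 'e) \<Rightarrow> ('z \<Rightarrow> 'e) hspace \<Rightarrow> bool"
  where "rkhs \<Omega> K H \<longleftrightarrow> hilbert H \<and>
    (\<forall>f\<in>hcarrier H. \<forall>z. z \<notin> \<Omega> \<longrightarrow> f z = 0) \<and>
    hdense_span H {kernel_fun \<Omega> K w \<eta> | w \<eta>. w \<in> \<Omega>} \<and>
    (\<forall>f\<in>hcarrier H. \<forall>w\<in>\<Omega>. \<forall>\<eta>. cinner (f w) \<eta> = hinner H f (kernel_fun \<Omega> K w \<eta>))"

definition coord_mult :: "'n \<Rightarrow> (complex ^ 'n \<Rightarrow> 'e::complex_vector) \<Rightarrow> complex ^ 'n \<Rightarrow> 'e"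
  where "coord_mult j f = (\<lambda>z. (z $ j) *\<^sub>C f z)"

text \<open>Boundedness of the multiplication operators is automatic, by the closed graph theorem.\<close>

definition rkh_module ::
  "(complex ^ 'n) set \<Rightarrow> (complex ^ 'n \<Rightarrow> complex ^ 'n \<Rightarrow> 'e::chilbert_space \<Rightarrow>\<^sub>L 'e) \<Rightarrow>
   (complex ^ 'n \<Rightarrow> 'e) hspace \<Rightarrow> bool"
  where "rkh_module \<Omega> K H \<longleftrightarrow> holo_kernel \<Omega> K \<and> rkhs \<Omega> K H \<and>
    (\<forall>j. coord_mult j ` hcarrier H \<subseteq> hcarrier H)"

text \<open>A scalar kernel as a kernel with values in the bounded operators on the complex numbers.\<close>

definition scalar_kernel :: "('z \<Rightarrow> 'z \<Rightarrow> complex) \<Rightarrow> 'z \<Rightarrow> 'z \<Rightarrow> complex \<Rightarrow>\<^sub>L complex"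
  where "scalar_kernel g z w = g z w *\<^sub>C id_blinfun"

definition good_rkh_module ::
  "(complex ^ 'n) set \<Rightarrow> (complex ^ 'n \<Rightarrow> complex ^ 'n \<Rightarrow> complex) \<Rightarrow>
   (complex ^ 'n \<Rightarrow> complex) hspace \<Rightarrow> bool"
  where "good_rkh_module \<Omega> g H \<longleftrightarrow> rkh_module \<Omega> (scalar_kernel g) H \<and>
    (\<forall>w\<in>\<Omega>. (\<Inter>j. {f \<in> hcarrier H. hadj H H (coord_mult j) f - cnj (w $ j) *\<^sub>C f = 0})
      = range (\<lambda>c. c *\<^sub>C (\<lambda>z. if z \<in> \<Omega> then g z w else 0))) \<and>
    (\<exists>w0\<in>\<Omega>. \<forall>z\<in>\<Omega>. g z w0 = 1)"

text \<open>The tensor product of \<open>Hg\<close> and \<open>Es\<close> is given by \<open>(T, \<tau>)\<close>, as in \<^locale>\<open>hilbert_tensor\<close>.\<close>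

definition dilates ::
  "(complex ^ 'n \<Rightarrow> 'e::chilbert_space) hspace \<Rightarrow> (complex ^ 'n \<Rightarrow> complex) hspace \<Rightarrow>
   'f::complex_vector hspace \<Rightarrow> 't::complex_vector hspace \<Rightarrow>
   ((complex ^ 'n \<Rightarrow> complex) \<Rightarrow> 'f \<Rightarrow> 't) \<Rightarrow> bool"
  where "dilates HK Hg Es T \<tau> \<longleftrightarrow>
    (\<exists>V. hisometry HK T V \<and>
      (\<forall>i. \<forall>f\<in>hcarrier HK.
        tensor_op Hg Es T \<tau> (hadj Hg Hg (coord_mult i)) (\<lambda>x. x) (V f)
          = V (hadj HK HK (coord_mult i) f)))"

end

theory Submission
  imports Defs "HOL-Complex_Analysis.Cauchy_Integral_Formula"
begin

text \<open>If \<open>V\<close> is an isometry intertwining the adjoints, then \<open>V (K(\<cdot>,w) \<eta>)\<close> is a joint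
  eigenvector of the operators \<open>M\<^sub>i\<^sup>* \<otimes> I\<close>. Slicing in the second tensor factor and goodness of \<open>g\<close>
  show that it has the form \<open>g(\<cdot>,w) \<otimes> \<Psi>(w) \<eta>\<close>; comparing inner products gives the factorisation
  with \<open>\<Phi>(w) = \<Psi>(w)\<^sup>*\<close>. Because \<open>g(\<cdot>,w\<^sub>0) = 1\<close>, the vector \<open>\<Phi>(z) x\<close> is the value at \<open>z\<close> of
  \<open>V\<^sup>* (1 \<otimes> x)\<close>, so \<open>\<Phi>\<close> is strongly holomorphic, and uniform boundedness together with
  Cauchy's estimates upgrades this to the operator norm. Conversely,
  \<open>K(\<cdot>,w) \<eta> \<mapsto> g(\<cdot>,w) \<otimes> \<Phi>(w)\<^sup>* \<eta>\<close> preserves inner products and extends to the required isometry.\<close>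

section \<open>Complex Hilbert spaces\<close>

text \<open>\<open>hadj\<close> and \<open>tensor_op\<close> are definite descriptions, so nothing
  can be said about them before existence and uniqueness are proved on spaces with explicit
  carriers. For adjoints this is Riesz representation, which presupposes bounded coordinate
  multiplications; a module only asks that they map the space into itself, and boundedness is
  extracted from their known adjoint vectors on the total set of kernel functions. For an operator
  tensored with the identity, the obstacle is that an algebraic tensor has many representations, so
  neither well-definedness nor a norm bound is visible; orthogonal second factors remove the
  ambiguity. The remaining obstacle is the topology: membership in \<open>HK\<close> gives
  holomorphy of each single function z -> \<Phi>(z) x, while \<open>holo_on\<close> asks for a
  derivative in operator norm and the space of the \<open>x\<close> may be infinite-dimensional.
  What bridges the gap is a quadratic remainder estimate whose constants depend only on a bound and
  a radius.\<close>

interpretation CV: vector_space "scaleC :: complex \<Rightarrow> 'a::complex_vector \<Rightarrow> 'a"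
  by (rule vector_space_scaleC)

lemma hlinearD:
  assumes "hlinear H1 H2 A"
  shows "x \<in> hcarrier H1 \<Longrightarrow> A x \<in> hcarrier H2"
    and "\<lbrakk>x \<in> hcarrier H1; y \<in> hcarrier H1\<rbrakk> \<Longrightarrow> A (x + y) = A x + A y"
    and "x \<in> hcarrier H1 \<Longrightarrow> A (c *\<^sub>C x) = c *\<^sub>C A x"
  using assms by (auto simp: hlinear_def)

lemma hbounded_hlinear: "hbounded H1 H2 A \<Longrightarrow> hlinear H1 H2 A"
  by (simp add: hbounded_def)

context pre_hilbert
begin

lemma carrier_sum: "(\<And>i. i \<in> I \<Longrightarrow> x i \<in> hcarrier H) \<Longrightarrow> (\<Sum>i\<in>I. x i) \<in> hcarrier H"
  by (rule CV.subspace_sum[OF subspace])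

lemma span_carrier: "S \<subseteq> hcarrier H \<Longrightarrow> cspan S \<subseteq> hcarrier H"
  by (rule CV.span_minimal[OF _ subspace])

lemma inner_zero_right: "y \<in> hcarrier H \<Longrightarrow> hinner H y 0 = 0"
  using inner_zero_left[of y] inner_commute[of y 0] carrier_zero by simp

lemma inner_diff_left:
  "\<lbrakk>x \<in> hcarrier H; y \<in> hcarrier H; z \<in> hcarrier H\<rbrakk>
    \<Longrightarrow> hinner H (x - y) z = hinner H x z - hinner H y z"
  using inner_add_left[of "x - y" y z] carrier_diff by simp

lemma inner_diff_right:
  "\<lbrakk>x \<in> hcarrier H; y \<in> hcarrier H; z \<in> hcarrier H\<rbrakk>
    \<Longrightarrow> hinner H z (x - y) = hinner H z x - hinner H z y"
  using inner_add_right[of "x - y" y z] carrier_diff by simp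

lemma inner_sum_left:
  assumes "\<And>i. i \<in> I \<Longrightarrow> x i \<in> hcarrier H" "y \<in> hcarrier H"
  shows "hinner H (\<Sum>i\<in>I. x i) y = (\<Sum>i\<in>I. hinner H (x i) y)"
  using assms(1)
proof (induction I rule: infinite_finite_induct)
  case (insert i I)
  then show ?case
    using assms(2) by (simp add: inner_add_left carrier_sum)
qed (simp_all add: inner_zero_left assms(2))

lemma inner_sum_right:
  assumes "\<And>i. i \<in> I \<Longrightarrow> x i \<in> hcarrier H" "y \<in> hcarrier H"
  shows "hinner H y (\<Sum>i\<in>I. x i) = (\<Sum>i\<in>I. hinner H y (x i))"
  using assms(1)
proof (induction I rule: infinite_finite_induct)
  case (insert i I)
  then show ?case
    using assms(2) by (simp add: inner_add_right carrier_sum)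
qed (simp_all add: inner_zero_right assms(2))

lemma inner_eqI:
  assumes "x \<in> hcarrier H" "y \<in> hcarrier H"
    and "\<And>u. u \<in> hcarrier H \<Longrightarrow> hinner H u x = hinner H u y"
  shows "x = y"
proof -
  have "hinner H (x - y) (x - y) = 0"
    using assms carrier_diff by (simp add: inner_diff_right)
  then show ?thesis
    using inner_self_eq_0[of "x - y"] assms carrier_diff by simp
qed

lemma hnorm_zero: "hnorm H 0 = 0"
  using hnorm_eq_0 carrier_zero by simp

lemma hnorm_scaleC:
  assumes "x \<in> hcarrier H"
  shows "hnorm H (a *\<^sub>C x) = cmod a * hnorm H x"
proof -
  have "(hnorm H (a *\<^sub>C x))\<^sup>2 = (cmod a * hnorm H x)\<^sup>2"
    using hnorm_add_sq[OF carrier_zero assms, of a] assms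
    by (simp add: hnorm_zero inner_zero_left power_mult_distrib)
  then show ?thesis
    using assms hnorm_nonneg carrier_scaleC by (simp add: power2_eq_iff_nonneg)
qed

lemma hnorm_diff_triangle:
  assumes "x \<in> hcarrier H" "y \<in> hcarrier H" "z \<in> hcarrier H"
  shows "hnorm H (x - z) \<le> hnorm H (x - y) + hnorm H (y - z)"
  using hnorm_triangle[of "x - y" "y - z"] assms carrier_diff by simp

lemma hnorm_le_diff:
  assumes "x \<in> hcarrier H" "y \<in> hcarrier H"
  shows "hnorm H x \<le> hnorm H y + hnorm H (x - y)"
  using hnorm_triangle[of y "x - y"] assms carrier_diff by simp

lemma hnorm_diff_approx:
  assumes "x \<in> hcarrier H" "y \<in> hcarrier H"
  shows "\<bar>hnorm H x - hnorm H y\<bar> \<le> hnorm H (x - y)"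
  using hnorm_le_diff[OF assms] hnorm_le_diff[OF assms(2,1)] hnorm_minus_commute[OF assms]
  by linarith

text \<open>The free constant lets a caller hand over an estimate of the form \<open>C * e\<close>
  without first rescaling its tolerance; dividing by \<open>\<bar>C\<bar> + 1\<close> copes with any
  sign of \<open>C\<close>.\<close>

lemma eq_if_hnorm_arbitrarily_small:
  assumes "x \<in> hcarrier H" "y \<in> hcarrier H" "\<And>e. e > 0 \<Longrightarrow> hnorm H (x - y) \<le> C * e"
  shows "x = y"
proof -
  have nn: "0 \<le> hnorm H (x - y)" by (simp add: assms carrier_diff hnorm_nonneg)
  have "hnorm H (x - y) \<le> 0"
  proof (rule field_le_epsilon)
    fix e :: real assume "0 < e"
    then have p: "e / (\<bar>C\<bar> + 1) > 0" by simp
    have "hnorm H (x - y) \<le> C * (e / (\<bar>C\<bar> + 1))" by (rule assms(3)[OF p])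
    also have "\<dots> \<le> (\<bar>C\<bar> + 1) * (e / (\<bar>C\<bar> + 1))"
      by (rule mult_right_mono) (use p in auto)
    also have "\<dots> = e" by simp
    finally show "hnorm H (x - y) \<le> 0 + e" by simp
  qed
  then show ?thesis
    using nn hnorm_eq_0[of "x - y"] assms carrier_diff by simp
qed

lemma parallelogram:
  assumes "x \<in> hcarrier H" "y \<in> hcarrier H"
  shows "(hnorm H (x + y))\<^sup>2 + (hnorm H (x - y))\<^sup>2 = 2 * (hnorm H x)\<^sup>2 + 2 * (hnorm H y)\<^sup>2"
  using hnorm_add_sq[OF assms, of 1] hnorm_add_sq[OF assms, of "- 1"] by (simp add: scaleC_one)

end

section \<open>Consequences of completeness: Riesz representation and uniform boundedness\<close>

lemma (in hilbert) Cauchy_convergent: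
  assumes "\<And>n. \<sigma> n \<in> hcarrier H"
    and "\<And>e. e > 0 \<Longrightarrow> \<exists>N. \<forall>m\<ge>N. \<forall>n\<ge>N. hnorm H (\<sigma> m - \<sigma> n) < e"
  obtains l where "l \<in> hcarrier H" "(\<lambda>n. hnorm H (\<sigma> n - l)) \<longlonglongrightarrow> 0"
proof -
  interpret M: Metric_space "hcarrier H" "hdist H" by (rule metric_space)
  have "M.MCauchy \<sigma>"
    using assms unfolding M.MCauchy_def by (auto simp: hdist_def)
  then obtain l where l: "limitin M.mtopology \<sigma> l sequentially"
    using complete M.mcomplete_def by blast
  then have lH: "l \<in> hcarrier H" using M.limitin_mspace by blast
  have "(\<lambda>n. hdist H (\<sigma> n) l) \<longlonglongrightarrow> 0"
    using l M.limitin_metric_dist_null by blast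
  then have "(\<lambda>n. hnorm H (\<sigma> n - l)) \<longlonglongrightarrow> 0"
    using assms(1) lH by (simp add: hdist_def)
  with lH show ?thesis using that by blast
qed

text \<open>The representing vector minimises \<open>u \<mapsto> \<parallel>u\<parallel>\<^sup>2 - 2 Re (\<phi> u)\<close>.\<close>

lemma (in hilbert) riesz:
  assumes add: "\<And>u v. \<lbrakk>u \<in> hcarrier H; v \<in> hcarrier H\<rbrakk> \<Longrightarrow> \<phi> (u + v) = \<phi> u + \<phi> v"
    and scale: "\<And>a u. u \<in> hcarrier H \<Longrightarrow> \<phi> (a *\<^sub>C u) = a * \<phi> u"
    and bound: "\<And>u. u \<in> hcarrier H \<Longrightarrow> cmod (\<phi> u) \<le> C * hnorm H u"
  obtains y where "y \<in> hcarrier H" "\<And>u. u \<in> hcarrier H \<Longrightarrow> \<phi> u = hinner H u y"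
proof -
  define J where "J u = (hnorm H u)\<^sup>2 - 2 * Re (\<phi> u)" for u
  define d where "d = Inf (J ` hcarrier H)"
  \<comment> \<open>Completing the square: \<open>J u\<close> is at least t^2 - 2 C t with t the
    norm of \<open>u\<close>, hence at least -C^2.\<close>
  have J_lower: "- C\<^sup>2 \<le> J u" if "u \<in> hcarrier H" for u
  proof -
    have "Re (\<phi> u) \<le> C * hnorm H u"
      using bound[OF that] complex_Re_le_cmod order_trans by blast
    moreover have "0 \<le> (hnorm H u - C)\<^sup>2" by simp
    ultimately show ?thesis unfolding J_def by (simp add: power2_diff mult.commute)
  qed
  have bdd: "bdd_below (J ` hcarrier H)"
    by (rule bdd_belowI[of _ "- C\<^sup>2"]) (use J_lower in auto)
  have d_le: "d \<le> J u" if "u \<in> hcarrier H" for u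
    unfolding d_def by (rule cInf_lower) (use that bdd in auto)
  have "\<exists>u\<in>hcarrier H. J u < d + inverse (Suc n)" for n
  proof -
    have "Inf (J ` hcarrier H) < d + inverse (Suc n)" by (simp add: d_def)
    then show ?thesis
      using cInf_less_iff[OF _ bdd] carrier_zero by blast
  qed
  then obtain \<sigma> where \<sigma>: "\<And>n. \<sigma> n \<in> hcarrier H" "\<And>n. J (\<sigma> n) < d + inverse (Suc n)"
    by metis
  \<comment> \<open>Parallelogram law at the midpoint \<open>w\<close>: the linear parts cancel in J
    u + J v - 2 J w, which leaves half of the squared distance, and \<open>J w\<close> is at least
    \<open>d\<close>. Hence minimising sequences are Cauchy.\<close>
  have J_par: "(hnorm H (u - v))\<^sup>2 \<le> 2 * (J u + J v - 2 * d)"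
    if "u \<in> hcarrier H" "v \<in> hcarrier H" for u v
  proof -
    define w where "w = (1/2) *\<^sub>C (u + v)"
    have uv: "u + v \<in> hcarrier H" using that carrier_add by simp
    then have w: "w \<in> hcarrier H" by (simp add: w_def carrier_scaleC)
    have "hnorm H (u + v) = 2 * hnorm H w"
      using hnorm_scaleC[OF uv, of "1/2"] by (simp add: w_def)
    moreover have "Re (\<phi> w) = (Re (\<phi> u) + Re (\<phi> v)) / 2"
    proof -
      have "\<phi> w = (\<phi> u + \<phi> v) / 2"
        using scale[OF uv, of "1/2"] add[OF that] by (simp add: w_def)
      then show ?thesis by (simp only: Re_divide_numeral plus_complex.sel)
    qed
    ultimately have "4 * J w = (hnorm H (u + v))\<^sup>2 - 4 * (Re (\<phi> u) + Re (\<phi> v))"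
      by (simp add: J_def power_mult_distrib)
    moreover have "d \<le> J w" using d_le w by simp
    ultimately show ?thesis
      using parallelogram[OF that] unfolding J_def by simp
  qed
  have "\<exists>N. \<forall>m\<ge>N. \<forall>n\<ge>N. hnorm H (\<sigma> m - \<sigma> n) < e" if "e > 0" for e
  proof -
    have "e\<^sup>2 / 4 > 0" using that by simp
    then obtain N where N: "inverse (real (Suc N)) < e\<^sup>2 / 4" using reals_Archimedean by blast
    have "hnorm H (\<sigma> m - \<sigma> n) < e" if "m \<ge> N" "n \<ge> N" for m n
    proof -
      have "J (\<sigma> k) < d + e\<^sup>2 / 4" if "k \<ge> N" for k
      proof -
        have "inverse (real (Suc k)) \<le> inverse (real (Suc N))"
          using that by (simp add: le_imp_inverse_le)
        with N have "d + inverse (real (Suc k)) < d + e\<^sup>2 / 4"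
          by (meson add_strict_left_mono le_less_trans)
        with \<sigma>(2)[of k] show ?thesis by (rule less_trans)
      qed
      from this[OF that(1)] this[OF that(2)]
      have "(hnorm H (\<sigma> m - \<sigma> n))\<^sup>2 < e\<^sup>2"
        using J_par[OF \<sigma>(1) \<sigma>(1), of m n] by simp
      then show ?thesis using \<open>e > 0\<close> power2_less_imp_less by force
    qed
    then show ?thesis by blast
  qed
  then obtain y where y: "y \<in> hcarrier H" "(\<lambda>n. hnorm H (\<sigma> n - y)) \<longlonglongrightarrow> 0"
    using Cauchy_convergent[of \<sigma>] \<sigma>(1) by blast
  have norm_lim: "(\<lambda>n. hnorm H (\<sigma> n)) \<longlonglongrightarrow> hnorm H y"
    using \<sigma>(1) y hnorm_diff_approx[of "\<sigma> _" y] by (intro Lim_null_comparison[OF _ y(2), THEN LIM_zero_cancel]) auto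
  have \<phi>_diff: "\<phi> (u - v) = \<phi> u - \<phi> v" if "u \<in> hcarrier H" "v \<in> hcarrier H" for u v
    using add[of "u - v" v] that carrier_diff by simp
  have "(\<lambda>n. C * hnorm H (\<sigma> n - y)) \<longlonglongrightarrow> 0"
    using tendsto_mult_right_zero[OF y(2)] by blast
  then have "(\<lambda>n. \<phi> (\<sigma> n) - \<phi> y) \<longlonglongrightarrow> 0"
    by (rule Lim_null_comparison[rotated])
      (use \<sigma>(1) y(1) bound carrier_diff in \<open>auto simp flip: \<phi>_diff\<close>)
  then have "(\<lambda>n. \<phi> (\<sigma> n)) \<longlonglongrightarrow> \<phi> y" by (rule LIM_zero_cancel)
  then have "(\<lambda>n. J (\<sigma> n)) \<longlonglongrightarrow> J y"
    unfolding J_def by (intro tendsto_intros norm_lim)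
  moreover have "(\<lambda>n. d + inverse (real (Suc n))) \<longlonglongrightarrow> d + 0"
    by (intro tendsto_intros LIMSEQ_inverse_real_of_nat)
  ultimately have "J y \<le> d + 0"
    by (rule LIMSEQ_le) (use \<sigma>(2) less_imp_le in blast)
  then have J_min: "J y \<le> J u" if "u \<in> hcarrier H" for u
    using d_le[OF that] by simp
  have "\<phi> u = hinner H u y" if u: "u \<in> hcarrier H" for u
  proof -
    \<comment> \<open>First variation: moving the minimiser by \<open>a *\<^sub>C u\<close> changes
      \<open>J\<close> by 2 Re (a q) plus a quadratic term. The chosen \<open>a\<close> makes the
      first summand -2 |q|^2 / n and the second at most |q|^2 / n, so minimality forces q = 0. The
      \<open>+ 1\<close> in \<open>n\<close> keeps the denominator positive when u = 0.\<close>
    define q where "q = hinner H u y - \<phi> u"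
    define n where "n = (hnorm H u)\<^sup>2 + 1"
    define a where "a = - cnj q / complex_of_real n"
    have n: "n > 0" unfolding n_def by (simp add: add_nonneg_pos)
    have au: "a *\<^sub>C u \<in> hcarrier H" using u carrier_scaleC by simp
    have "J (y + a *\<^sub>C u) = J y + 2 * Re (a * q) + (cmod a)\<^sup>2 * (hnorm H u)\<^sup>2"
      using add[OF y(1) au] scale[OF u] hnorm_add_sq[OF y(1) u, of a]
        inner_commute[OF y(1) u]
      by (simp add: J_def q_def algebra_simps)
    moreover have "J y \<le> J (y + a *\<^sub>C u)" using J_min carrier_add y(1) au by blast
    moreover have "(cmod a)\<^sup>2 * (hnorm H u)\<^sup>2 \<le> (cmod a)\<^sup>2 * n"
      by (rule mult_left_mono) (simp_all add: n_def)
    moreover have "(cmod a)\<^sup>2 * n = (cmod q)\<^sup>2 / n"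
      using n by (simp add: a_def norm_divide power_divide power2_eq_square)
    moreover have "a * q = complex_of_real (- ((cmod q)\<^sup>2 / n))"
      by (simp add: a_def complex_norm_square[symmetric] mult.commute)
    ultimately have "(cmod q)\<^sup>2 / n \<le> 0" by simp
    then have "q = 0" using n by (simp add: divide_le_0_iff)
    then show ?thesis by (simp add: q_def)
  qed
  with y(1) show ?thesis using that by blast
qed

text \<open>A gliding hump argument that needs no Baire category.\<close>

lemma (in hilbert) uniform_boundedness:
  assumes Y: "Y \<subseteq> hcarrier H"
    and ptw: "\<And>u. u \<in> hcarrier H \<Longrightarrow> \<exists>C. \<forall>y\<in>Y. cmod (hinner H u y) \<le> C"
  shows "\<exists>C. \<forall>y\<in>Y. hnorm H y \<le> C"
proof (rule ccontr)
  assume "\<not> ?thesis"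
  \<comment> \<open>The n-th hump has length 3^-n and half of its effect will survive in the limit;
    the threshold 2 n 3^n is what makes that half exceed \<open>n\<close>.\<close>
  then have "\<forall>n. \<exists>y\<in>Y. 2 * real n * 3 ^ n < hnorm H y"
    by (meson not_le)
  then obtain y where yY: "\<And>n. y n \<in> Y" and y: "\<And>n. 2 * real n * 3 ^ n < hnorm H (y n)"
    by metis
  have yH: "y n \<in> hcarrier H" for n using yY Y by blast
  have ypos: "hnorm H (y n) > 0" for n
    using y[of n] by (smt (verit) of_nat_0_le_iff zero_le_mult_iff zero_le_power)
  define r :: "nat \<Rightarrow> real" where "r n = (1/3) ^ n" for n
  \<comment> \<open>Let \<open>u\<close> have length \<open>r n\<close> and the direction of
    \<open>y n\<close>. The pairings of \<open>x + u\<close> and \<open>x - u\<close> with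
    \<open>y n\<close> differ by twice that of \<open>u\<close>, so one of them is at least as large
    as that of \<open>u\<close>, whatever \<open>x\<close> was.\<close>
  have step: "\<exists>x'. x' \<in> hcarrier H \<and> hnorm H (x' - x) \<le> r n \<and>
      r n * hnorm H (y n) \<le> cmod (hinner H x' (y n))" if x: "x \<in> hcarrier H" for x n
  proof -
    define u where "u = complex_of_real (r n / hnorm H (y n)) *\<^sub>C y n"
    have u: "u \<in> hcarrier H" using yH carrier_scaleC by (simp add: u_def)
    have nu: "hnorm H u = r n"
      using ypos[of n] by (simp add: u_def hnorm_scaleC[OF yH] r_def norm_divide norm_mult norm_power)
    have "hinner H u (y n) = complex_of_real (r n * hnorm H (y n))"
      using ypos[of n] inner_self[OF yH, of n]
      by (simp add: u_def inner_scaleC_left[OF yH yH] power2_eq_square)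
    then have cu: "cmod (hinner H u (y n)) = r n * hnorm H (y n)"
      using ypos[of n] by (simp add: norm_mult r_def norm_power)
    have "2 * hinner H u (y n) = hinner H (x + u) (y n) - hinner H (x - u) (y n)"
      using x u yH by (simp add: inner_add_left inner_diff_left)
    then have "2 * cmod (hinner H u (y n))
        \<le> cmod (hinner H (x + u) (y n)) + cmod (hinner H (x - u) (y n))"
      by (metis norm_triangle_ineq4 norm_mult norm_numeral)
    then consider "cmod (hinner H u (y n)) \<le> cmod (hinner H (x + u) (y n))"
      | "cmod (hinner H u (y n)) \<le> cmod (hinner H (x - u) (y n))" by linarith
    then show ?thesis
    proof cases
      case 1
      then show ?thesis
        using x u carrier_add nu cu by (intro exI[of _ "x + u"]) simp
    next
      case 2
      have "hnorm H (x - u - x) = r n"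
        using hnorm_minus_commute[of "x - u" x] x u carrier_diff nu by simp
      with 2 show ?thesis
        using x u carrier_diff cu by (intro exI[of _ "x - u"]) simp
    qed
  qed
  obtain x where xH: "\<And>n. x n \<in> hcarrier H"
    and x: "\<And>n. hnorm H (x (Suc n) - x n) \<le> r n"
      "\<And>n. r n * hnorm H (y n) \<le> cmod (hinner H (x (Suc n)) (y n))"
    using dependent_nat_choice[of "\<lambda>_ x. x \<in> hcarrier H" "\<lambda>n x x'. hnorm H (x' - x) \<le> r n \<and>
      r n * hnorm H (y n) \<le> cmod (hinner H x' (y n))"] step carrier_zero by metis
  \<comment> \<open>The geometric sum of 3^-j over n <= j < n + k equals 3/2 (3^-n -
    3^-(n+k)).\<close>
  have tail: "hnorm H (x (n + k) - x n) \<le> 3/2 * (r n - r (n + k))" for n k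
  proof (induction k)
    case 0
    then show ?case by (simp add: hnorm_zero)
  next
    case (Suc k)
    have "r (n + Suc k) = r (n + k) / 3" by (simp add: r_def)
    then show ?case
      using Suc x(1)[of "n + k"] hnorm_diff_triangle[of "x (n + Suc k)" "x (n + k)" "x n"] xH
      by simp
  qed
  have r_pos: "r n > 0" for n by (simp add: r_def)
  have tail': "hnorm H (x m - x n) \<le> 3/2 * r n" if "m \<ge> n" for m n
    using tail[of n "m - n"] r_pos[of m] that by simp
  have r0: "r \<longlonglongrightarrow> 0" unfolding r_def by (simp add: LIMSEQ_realpow_zero)
  have "\<exists>N. \<forall>m\<ge>N. \<forall>n\<ge>N. hnorm H (x m - x n) < e" if "e > 0" for e
  proof -
    have "\<forall>\<^sub>F n in sequentially. r n < e / 3"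
      using r0 that by (intro order_tendstoD) auto
    then obtain N where N: "r N < e / 3" unfolding eventually_sequentially by blast
    have "hnorm H (x m - x n) < e" if "m \<ge> N" "n \<ge> N" for m n
      using hnorm_diff_triangle[of "x m" "x N" "x n"] xH hnorm_minus_commute[of "x N" "x n"]
        tail'[OF that(1)] tail'[OF that(2)] N by simp
    then show ?thesis by blast
  qed
  then obtain l where l: "l \<in> hcarrier H" "(\<lambda>n. hnorm H (x n - l)) \<longlonglongrightarrow> 0"
    using Cauchy_convergent[of x] xH by blast
  \<comment> \<open>The index \<open>Suc n\<close> matters: all corrections after the n-th hump add
    up to at most 3/2 \<open>r (Suc n)\<close> = \<open>r n / 2\<close>, so they destroy at most
    half of the pairing gained with \<open>y n\<close>.\<close>
  have lim: "hnorm H (x (Suc n) - l) \<le> r n / 2" for n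
  proof -
    have "(\<lambda>m. 3/2 * r (Suc n) + hnorm H (x m - l)) \<longlonglongrightarrow> 3/2 * r (Suc n) + 0"
      by (intro tendsto_intros l(2))
    moreover have "hnorm H (x (Suc n) - l) \<le> 3/2 * r (Suc n) + hnorm H (x m - l)"
      if "m \<ge> Suc n" for m
      using tail'[OF that] hnorm_minus_commute[OF xH xH, of "Suc n" m]
        hnorm_diff_triangle[OF xH xH l(1), of "Suc n" m] by simp
    ultimately have "hnorm H (x (Suc n) - l) \<le> 3/2 * r (Suc n) + 0"
      using LIMSEQ_le_const by blast
    then show ?thesis by (simp add: r_def)
  qed
  have big: "real n < cmod (hinner H l (y n))" for n
  proof -
    have "cmod (hinner H (x (Suc n) - l) (y n)) \<le> r n / 2 * hnorm H (y n)"
      using cauchy_schwarz[of "x (Suc n) - l" "y n"] lim[of n] ypos[of n] xH l(1) yH carrier_diff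
      by (meson less_imp_le mult_right_mono order_trans)
    moreover have "hinner H (x (Suc n)) (y n)
        = hinner H l (y n) + hinner H (x (Suc n) - l) (y n)"
      using xH l(1) yH by (simp add: inner_diff_left)
    ultimately have "r n / 2 * hnorm H (y n) \<le> cmod (hinner H l (y n))"
      using x(2)[of n] norm_triangle_ineq[of "hinner H l (y n)" "hinner H (x (Suc n) - l) (y n)"]
      by simp
    moreover have "real n < r n / 2 * hnorm H (y n)"
      using mult_strict_left_mono[OF y[of n], of "r n / 2"] r_pos[of n]
      by (simp add: r_def power_one_over field_simps)
    ultimately show ?thesis by simp
  qed
  obtain C where "\<forall>y\<in>Y. cmod (hinner H l y) \<le> C" using ptw[OF l(1)] by blast
  then have "real n < C" for n using big[of n] yY[of n] by force
  then show False using reals_Archimedean2[of C] by (meson less_asym)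
qed

section \<open>Bounded operators\<close>

lemma hlinear_diff:
  assumes "hlinear H1 H2 A" "pre_hilbert H1" "x \<in> hcarrier H1" "y \<in> hcarrier H1"
  shows "A (x - y) = A x - A y"
  using hlinearD(2)[OF assms(1), of "x - y" y] pre_hilbert.carrier_diff[OF assms(2-4)] assms(4)
  by simp

lemma hlinear_compose:
  "\<lbrakk>hlinear H1 H2 A; hlinear H2 H3 B\<rbrakk> \<Longrightarrow> hlinear H1 H3 (\<lambda>x. B (A x))"
  by (simp add: hlinear_def)

lemma hbounded_bound:
  assumes "hbounded H1 H2 A" "pre_hilbert H1"
  obtains C where "C \<ge> 0" "\<And>x. x \<in> hcarrier H1 \<Longrightarrow> hnorm H2 (A x) \<le> C * hnorm H1 x"
proof -
  from assms(1) obtain C where C: "\<forall>x\<in>hcarrier H1. hnorm H2 (A x) \<le> C * hnorm H1 x"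
    by (auto simp: hbounded_def)
  have "hnorm H2 (A x) \<le> \<bar>C\<bar> * hnorm H1 x" if "x \<in> hcarrier H1" for x
    using C that mult_right_mono[OF abs_ge_self pre_hilbert.hnorm_nonneg[OF assms(2) that], of C]
    by force
  then show ?thesis using that[of "\<bar>C\<bar>"] by simp
qed

lemma hbounded_compose:
  assumes "hbounded H1 H2 A" "hbounded H2 H3 B" "pre_hilbert H1" "pre_hilbert H2"
  shows "hbounded H1 H3 (\<lambda>x. B (A x))"
proof -
  obtain a where a: "a \<ge> 0" "\<And>x. x \<in> hcarrier H1 \<Longrightarrow> hnorm H2 (A x) \<le> a * hnorm H1 x"
    using hbounded_bound[OF assms(1,3)] by blast
  obtain b where b: "b \<ge> 0" "\<And>x. x \<in> hcarrier H2 \<Longrightarrow> hnorm H3 (B x) \<le> b * hnorm H2 x"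
    using hbounded_bound[OF assms(2,4)] by blast
  note lin = hbounded_hlinear[OF assms(1)] hbounded_hlinear[OF assms(2)]
  have "hnorm H3 (B (A x)) \<le> (b * a) * hnorm H1 x" if "x \<in> hcarrier H1" for x
    using b(2)[OF hlinearD(1)[OF lin(1) that]] mult_left_mono[OF a(2)[OF that] b(1)]
    by (simp add: mult.assoc)
  then show ?thesis using hlinear_compose[OF lin] by (auto simp: hbounded_def)
qed

lemma hisometry_hbounded: "hisometry H1 H2 V \<Longrightarrow> hbounded H1 H2 V"
  by (auto simp: hisometry_def hbounded_def intro!: exI[of _ 1])

lemma hlinear_eq_on_span:
  assumes "hlinear H1 H2 A" "hlinear H1 H2 B" "pre_hilbert H1" "S \<subseteq> hcarrier H1"
    and "\<And>s. s \<in> S \<Longrightarrow> A s = B s" "x \<in> cspan S"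
  shows "A x = B x"
proof -
  interpret H1: pre_hilbert H1 by fact
  have "csubspace {x \<in> hcarrier H1. A x = B x}"
    using hlinear_diff[OF assms(1,3), of 0 0] hlinear_diff[OF assms(2,3), of 0 0]
    by (intro CV.subspaceI)
      (simp_all add: H1.carrier_zero H1.carrier_add H1.carrier_scaleC hlinearD[OF assms(1)] hlinearD[OF assms(2)])
  then have "cspan S \<subseteq> {x \<in> hcarrier H1. A x = B x}"
    using assms(4,5) by (intro CV.span_minimal) auto
  with assms(6) show ?thesis by blast
qed

lemma hbounded_eq_on_dense:
  assumes A: "hbounded H1 H2 A" and B: "hbounded H1 H2 B"
    and "pre_hilbert H1" "pre_hilbert H2" and S: "hdense_span H1 S"
    and eq: "\<And>s. s \<in> S \<Longrightarrow> A s = B s" and x: "x \<in> hcarrier H1"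
  shows "A x = B x"
proof -
  interpret H1: pre_hilbert H1 by fact
  interpret H2: pre_hilbert H2 by fact
  note lA = hbounded_hlinear[OF A] and lB = hbounded_hlinear[OF B]
  obtain a where a: "a \<ge> 0" "\<And>x. x \<in> hcarrier H1 \<Longrightarrow> hnorm H2 (A x) \<le> a * hnorm H1 x"
    using hbounded_bound[OF A assms(3)] by blast
  obtain b where b: "b \<ge> 0" "\<And>x. x \<in> hcarrier H1 \<Longrightarrow> hnorm H2 (B x) \<le> b * hnorm H1 x"
    using hbounded_bound[OF B assms(3)] by blast
  have SH: "S \<subseteq> hcarrier H1" using S by (simp add: hdense_span_def)
  show ?thesis
  proof (rule H2.eq_if_hnorm_arbitrarily_small)
    show "A x \<in> hcarrier H2" "B x \<in> hcarrier H2"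
      using hlinearD(1)[OF lA x] hlinearD(1)[OF lB x] by auto
    fix e :: real assume "e > 0"
    then obtain y where y: "y \<in> cspan S" "hnorm H1 (x - y) < e"
      using S x unfolding hdense_span_def by blast
    have yH: "y \<in> hcarrier H1" using H1.span_carrier[OF SH] y(1) by blast
    have xy: "x - y \<in> hcarrier H1" using x yH H1.carrier_diff by simp
    have "A y = B y"
      by (rule hlinear_eq_on_span[OF lA lB assms(3) SH eq y(1)])
    then have "A x - B x = A (x - y) - B (x - y)"
      by (simp add: hlinear_diff[OF lA assms(3) x yH] hlinear_diff[OF lB assms(3) x yH])
    moreover have "hnorm H2 (A (x - y) - B (x - y)) \<le> hnorm H2 (A (x - y)) + hnorm H2 (B (x - y))"
      using H2.hnorm_diff_triangle[of "A (x - y)" 0 "B (x - y)"] H2.hnorm_minus_commute[of 0 "B (x - y)"]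
        hlinearD(1)[OF lA xy] hlinearD(1)[OF lB xy] H2.carrier_zero by simp
    moreover have "hnorm H2 (A (x - y)) + hnorm H2 (B (x - y)) \<le> (a + b) * hnorm H1 (x - y)"
      using a(2)[OF xy] b(2)[OF xy] by (simp add: distrib_right)
    moreover have "(a + b) * hnorm H1 (x - y) \<le> (a + b) * e"
      using y(2) a(1) b(1) by (intro mult_left_mono) auto
    ultimately show "hnorm H2 (A x - B x) \<le> (a + b) * e" by simp
  qed
qed

text \<open>The linear relation \<open>G\<close> is the graph of an operator with dense domain; the operator and
  its continuous extension need not be named beforehand.\<close>

lemma bounded_extension:
  assumes "pre_hilbert H1" "hilbert H2"
    and G: "G \<subseteq> hcarrier H1 \<times> hcarrier H2"
    and add: "\<And>s r s' r'. \<lbrakk>(s, r) \<in> G; (s', r') \<in> G\<rbrakk> \<Longrightarrow> (s + s', r + r') \<in> G"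
    and scale: "\<And>a s r. (s, r) \<in> G \<Longrightarrow> (a *\<^sub>C s, a *\<^sub>C r) \<in> G"
    and dense: "\<And>x e. \<lbrakk>x \<in> hcarrier H1; e > 0\<rbrakk> \<Longrightarrow> \<exists>(s, r)\<in>G. hnorm H1 (x - s) < e"
    and C: "C \<ge> 0" and bound: "\<And>s r. (s, r) \<in> G \<Longrightarrow> hnorm H2 r \<le> C * hnorm H1 s"
  obtains A where "hlinear H1 H2 A" "\<And>s r. (s, r) \<in> G \<Longrightarrow> A s = r"
    "\<And>x. x \<in> hcarrier H1 \<Longrightarrow> hnorm H2 (A x) \<le> C * hnorm H1 x"
    "\<And>x e. \<lbrakk>x \<in> hcarrier H1; e > 0\<rbrakk> \<Longrightarrow> \<exists>(s, r)\<in>G. hnorm H1 (x - s) < e \<and> hnorm H2 (A x - r) < e"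
proof -
  interpret H1: pre_hilbert H1 by fact
  interpret H2: hilbert H2 by fact
  \<comment> \<open>\<open>R\<close> is the closure of \<open>G\<close>. Density and completeness
    make it total, the bound makes it single-valued, and so it is the graph of the
    extension.\<close>
  define R where "R x y \<longleftrightarrow> x \<in> hcarrier H1 \<and> y \<in> hcarrier H2 \<and>
    (\<forall>e>0. \<exists>(s, r)\<in>G. hnorm H1 (x - s) < e \<and> hnorm H2 (y - r) < e)" for x y
  have GD: "s \<in> hcarrier H1" "r \<in> hcarrier H2" if "(s, r) \<in> G" for s r using G that by auto
  have G_diff: "hnorm H2 (r - r') \<le> C * hnorm H1 (s - s')" if "(s, r) \<in> G" "(s', r') \<in> G" for s r s' r'
    using bound[OF add[OF that(1) scale[OF that(2), of "- 1"]]]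
    by (simp add: CV.scale_minus_left scaleC_one)
  have R_G: "R s r" if "(s, r) \<in> G" for s r
    unfolding R_def using that GD[OF that] H1.hnorm_zero H2.hnorm_zero
    by (auto intro!: bexI[of _ "(s, r)"])
  have R_diff: "hnorm H2 (y - y') \<le> C * hnorm H1 (x - x')" if R: "R x y" "R x' y'" for x y x' y'
  proof (rule field_le_epsilon)
    fix e :: real assume e: "e > 0"
    define d where "d = e / (2 + 2 * C)"
    have d: "d > 0" and e_d: "e = 2 * d + C * (2 * d)"
    proof -
      have "2 + 2 * C > 0" using C by simp
      then have "d > 0" "e = (2 + 2 * C) * d" using e by (simp_all add: d_def)
      then show "d > 0" "e = 2 * d + C * (2 * d)" by (simp_all add: distrib_right)
    qed
    obtain s r where sr: "(s, r) \<in> G" "hnorm H1 (x - s) < d" "hnorm H2 (y - r) < d"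
      using R(1) d by (auto simp: R_def)
    obtain s' r' where sr': "(s', r') \<in> G" "hnorm H1 (x' - s') < d" "hnorm H2 (y' - r') < d"
      using R(2) d by (auto simp: R_def)
    have in1: "x \<in> hcarrier H1" "x' \<in> hcarrier H1" "s \<in> hcarrier H1" "s' \<in> hcarrier H1"
      and in2: "y \<in> hcarrier H2" "y' \<in> hcarrier H2" "r \<in> hcarrier H2" "r' \<in> hcarrier H2"
      using R GD[OF sr(1)] GD[OF sr'(1)] by (auto simp: R_def)
    have "hnorm H1 (s - s') \<le> hnorm H1 (x - x') + 2 * d"
      using H1.hnorm_diff_triangle[OF in1(3,1,4)] H1.hnorm_diff_triangle[OF in1(1,2,4)]
        H1.hnorm_minus_commute[OF in1(3,1)] sr(2) sr'(2) by linarith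
    then have "C * hnorm H1 (s - s') \<le> C * (hnorm H1 (x - x') + 2 * d)"
      using C by (rule mult_left_mono)
    moreover have "hnorm H2 (y - y') \<le> hnorm H2 (r - r') + 2 * d"
      using H2.hnorm_diff_triangle[OF in2(1,3,2)] H2.hnorm_diff_triangle[OF in2(3,4,2)]
        H2.hnorm_minus_commute[OF in2(4,2)] sr(3) sr'(3) by linarith
    ultimately have "hnorm H2 (y - y') \<le> C * (hnorm H1 (x - x') + 2 * d) + 2 * d"
      using G_diff[OF sr(1) sr'(1)] by linarith
    then show "hnorm H2 (y - y') \<le> C * hnorm H1 (x - x') + e"
      by (simp add: e_d distrib_left)
  qed
  have R_unique: "y = y'" if R: "R x y" "R x y'" for x y y'
  proof -
    have y: "y \<in> hcarrier H2" "y' \<in> hcarrier H2" using R by (auto simp: R_def)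
    have "hnorm H2 (y - y') \<le> 0" using R_diff[OF R] H1.hnorm_zero by simp
    then show ?thesis
      using y H2.hnorm_nonneg[of "y - y'"] H2.hnorm_eq_0[of "y - y'"] H2.carrier_diff by simp
  qed
  have R_add: "R (x + x') (y + y')" if R: "R x y" "R x' y'" for x y x' y'
    unfolding R_def
  proof (intro conjI allI impI)
    show "x + x' \<in> hcarrier H1" "y + y' \<in> hcarrier H2"
      using R H1.carrier_add H2.carrier_add by (auto simp: R_def)
    fix e :: real assume "e > 0"
    then have d: "e / 2 > 0" by simp
    obtain s r where sr: "(s, r) \<in> G" "hnorm H1 (x - s) < e/2" "hnorm H2 (y - r) < e/2"
      using R(1) d unfolding R_def by blast
    obtain s' r' where sr': "(s', r') \<in> G" "hnorm H1 (x' - s') < e/2" "hnorm H2 (y' - r') < e/2"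
      using R(2) d unfolding R_def by blast
    have in1: "x - s \<in> hcarrier H1" "x' - s' \<in> hcarrier H1"
      and in2: "y - r \<in> hcarrier H2" "y' - r' \<in> hcarrier H2"
      using R GD[OF sr(1)] GD[OF sr'(1)] H1.carrier_diff H2.carrier_diff by (auto simp: R_def)
    have "hnorm H1 (x + x' - (s + s')) < e"
      using H1.hnorm_triangle[OF in1] sr(2) sr'(2) by (simp add: algebra_simps)
    moreover have "hnorm H2 (y + y' - (r + r')) < e"
      using H2.hnorm_triangle[OF in2] sr(3) sr'(3) by (simp add: algebra_simps)
    ultimately show "\<exists>(s, r)\<in>G. hnorm H1 (x + x' - s) < e \<and> hnorm H2 (y + y' - r) < e"
      using add[OF sr(1) sr'(1)] by blast
  qed
  have R_scale: "R (a *\<^sub>C x) (a *\<^sub>C y)" if R: "R x y" for x y a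
    unfolding R_def
  proof (intro conjI allI impI)
    show "a *\<^sub>C x \<in> hcarrier H1" "a *\<^sub>C y \<in> hcarrier H2"
      using R H1.carrier_scaleC H2.carrier_scaleC by (auto simp: R_def)
    fix e :: real assume "e > 0"
    then have d: "e / (cmod a + 1) > 0" by (simp add: add_nonneg_pos)
    then obtain s r where sr: "(s, r) \<in> G" "hnorm H1 (x - s) < e / (cmod a + 1)"
        "hnorm H2 (y - r) < e / (cmod a + 1)"
      using R unfolding R_def by blast
    have in1: "x - s \<in> hcarrier H1" and in2: "y - r \<in> hcarrier H2"
      using R GD[OF sr(1)] H1.carrier_diff H2.carrier_diff by (auto simp: R_def)
    have less: "cmod a * t < e" if "t < e / (cmod a + 1)" "t \<ge> 0" for t
    proof -
      have "cmod a * t \<le> (cmod a + 1) * t" using that by (simp add: mult_right_mono)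
      also have "\<dots> < e" using that(1) norm_ge_zero[of a]
        by (simp add: less_divide_eq mult.commute split: if_splits)
      finally show ?thesis .
    qed
    have "hnorm H1 (a *\<^sub>C x - a *\<^sub>C s) < e"
      using H1.hnorm_scaleC[OF in1, of a] less[OF sr(2) H1.hnorm_nonneg[OF in1]]
      by (simp add: CV.scale_right_diff_distrib)
    moreover have "hnorm H2 (a *\<^sub>C y - a *\<^sub>C r) < e"
      using H2.hnorm_scaleC[OF in2, of a] less[OF sr(3) H2.hnorm_nonneg[OF in2]]
      by (simp add: CV.scale_right_diff_distrib)
    ultimately show "\<exists>(s, r)\<in>G. hnorm H1 (a *\<^sub>C x - s) < e \<and> hnorm H2 (a *\<^sub>C y - r) < e"
      using scale[OF sr(1), of a] by blast
  qed
  have R_ex: "\<exists>y. R x y" if x: "x \<in> hcarrier H1" for x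
  proof -
    have "\<exists>s r. (s, r) \<in> G \<and> hnorm H1 (x - s) < inverse (Suc n)" for n
      using dense[OF x, of "inverse (Suc n)"] by auto
    then obtain s r where sr: "\<And>n. (s n, r n) \<in> G" "\<And>n. hnorm H1 (x - s n) < inverse (Suc n)"
      by metis
    have sH: "s n \<in> hcarrier H1" and rH: "r n \<in> hcarrier H2" for n using GD[OF sr(1)] by auto
    have close: "\<exists>N. \<forall>n\<ge>N. hnorm H1 (x - s n) < e" if e: "e > 0" for e
    proof -
      obtain N where N: "inverse (real (Suc N)) < e" using reals_Archimedean[OF e] by blast
      have "hnorm H1 (x - s n) < e" if "n \<ge> N" for n
      proof -
        have "inverse (real (Suc n)) \<le> inverse (real (Suc N))"
          using that by (simp add: le_imp_inverse_le)
        then show ?thesis using sr(2)[of n] N by linarith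
      qed
      then show ?thesis by blast
    qed
    have "\<exists>N. \<forall>m\<ge>N. \<forall>n\<ge>N. hnorm H2 (r m - r n) < e" if e: "e > 0" for e
    proof -
      \<comment> \<open>The \<open>+ 1\<close> admits C = 0 and gives 2 C / (2 C + 1) < 1, hence a
        strict inequality at the end.\<close>
      have d: "e / (2 * C + 1) > 0" using e C by simp
      obtain N where N: "\<forall>n\<ge>N. hnorm H1 (x - s n) < e / (2 * C + 1)" using close[OF d] by blast
      have "hnorm H2 (r m - r n) < e" if "m \<ge> N" "n \<ge> N" for m n
      proof -
        have "hnorm H1 (s m - s n) \<le> 2 * (e / (2 * C + 1))"
          using H1.hnorm_diff_triangle[OF sH x sH, of m n] H1.hnorm_minus_commute[OF x sH, of m]
            N[rule_format, OF that(1)] N[rule_format, OF that(2)] by linarith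
        then have "C * hnorm H1 (s m - s n) \<le> C * (2 * (e / (2 * C + 1)))"
          using C by (rule mult_left_mono)
        also have "\<dots> = (2 * C) / (2 * C + 1) * e" by simp
        also have "\<dots> < 1 * e" using e C by (intro mult_strict_right_mono) simp_all
        also have "\<dots> = e" by simp
        finally show ?thesis using G_diff[OF sr(1) sr(1), of m n] by linarith
      qed
      then show ?thesis by blast
    qed
    then obtain y where y: "y \<in> hcarrier H2" "(\<lambda>n. hnorm H2 (r n - y)) \<longlonglongrightarrow> 0"
      using H2.Cauchy_convergent[of r] rH by blast
    have "R x y"
      unfolding R_def
    proof (intro conjI allI impI x y(1))
      fix e :: real assume e: "e > 0"
      obtain N where N: "\<forall>n\<ge>N. hnorm H1 (x - s n) < e" using close[OF e] by blast
      obtain M where M: "\<forall>n\<ge>M. hnorm H2 (r n - y) < e"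
        using order_tendstoD(2)[OF y(2) e] unfolding eventually_sequentially by blast
      have "hnorm H1 (x - s (max M N)) < e" "hnorm H2 (y - r (max M N)) < e"
        using N M[rule_format, of "max M N"] H2.hnorm_minus_commute[OF rH y(1), of "max M N"] by auto
      then show "\<exists>(s, r)\<in>G. hnorm H1 (x - s) < e \<and> hnorm H2 (y - r) < e"
        using sr(1) by blast
    qed
    then show ?thesis ..
  qed
  define A where "A x = (SOME y. R x y)" for x
  have RA: "R x (A x)" if "x \<in> hcarrier H1" for x
    unfolding A_def using R_ex[OF that] by (rule someI_ex)
  have lin: "hlinear H1 H2 A"
    unfolding hlinear_def
  proof (intro conjI ballI allI)
    fix x assume x: "x \<in> hcarrier H1"
    show "A x \<in> hcarrier H2" using RA[OF x] by (simp add: R_def)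
    show "A (c *\<^sub>C x) = c *\<^sub>C A x" for c
      using R_unique[OF RA R_scale[OF RA]] x H1.carrier_scaleC by blast
    fix y assume y: "y \<in> hcarrier H1"
    show "A (x + y) = A x + A y"
      using R_unique[OF RA R_add[OF RA RA]] x y H1.carrier_add by blast
  qed
  show ?thesis
  proof (rule that[of A])
    show "A s = r" if "(s, r) \<in> G" for s r
      using R_unique[OF RA R_G[OF that]] GD[OF that] by blast
    show "hnorm H2 (A x) \<le> C * hnorm H1 x" if "x \<in> hcarrier H1" for x
      using R_diff[OF RA[OF that] RA[OF H1.carrier_zero]] hlinear_diff[OF lin assms(1) that that]
      by simp
    \<comment> \<open>Simultaneous approximation of \<open>x\<close> and \<open>A x\<close> is
      exported because it carries norm identities, not only bounds, from \<open>G\<close> to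
      \<open>A\<close>.\<close>
    show "\<exists>(s, r)\<in>G. hnorm H1 (x - s) < e \<and> hnorm H2 (A x - r) < e"
      if "x \<in> hcarrier H1" "e > 0" for x e
      using RA[OF that(1)] that(2) by (simp add: R_def)
  qed (rule lin)
qed

text \<open>The adjoint vectors of all \<open>f\<close> in the unit ball of the span of
  \<open>S\<close> pair with a fixed \<open>u\<close> by at most the norm of \<open>A u\<close>, so
  uniform boundedness gives a common bound for them. Duality then returns a bound on
  \<open>A u\<close>, because the span is dense. This supplies boundedness of the coordinate
  multiplications.\<close>

lemma hellinger_toeplitz:
  assumes "hilbert H1" "pre_hilbert H2" and A: "hlinear H1 H2 A" and S: "hdense_span H2 S"
    and adj: "\<And>s. s \<in> S \<Longrightarrow> \<exists>y\<in>hcarrier H1. \<forall>u\<in>hcarrier H1. hinner H2 (A u) s = hinner H1 u y"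
  shows "hbounded H1 H2 A"
proof -
  interpret H1: hilbert H1 by fact
  interpret H2: pre_hilbert H2 by fact
  have AH: "A u \<in> hcarrier H2" if "u \<in> hcarrier H1" for u using hlinearD(1)[OF A that] .
  define adj where "adj f y \<longleftrightarrow> y \<in> hcarrier H1 \<and> (\<forall>u\<in>hcarrier H1. hinner H2 (A u) f = hinner H1 u y)" for f y
  define D where "D = {f \<in> hcarrier H2. \<exists>y. adj f y}"
  have SH: "S \<subseteq> hcarrier H2" using S by (simp add: hdense_span_def)
  have adj0: "adj 0 0"
    by (simp add: adj_def AH H1.carrier_zero H1.inner_zero_right H2.inner_zero_right)
  have adj_add: "adj (f + f') (y + y')"
    if "adj f y" "adj f' y'" "f \<in> hcarrier H2" "f' \<in> hcarrier H2" for f y f' y'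
    using that by (simp add: adj_def AH H1.carrier_add H1.inner_add_right H2.inner_add_right)
  have adj_scale: "adj (a *\<^sub>C f) (a *\<^sub>C y)" if "adj f y" "f \<in> hcarrier H2" for a f y
    using that by (simp add: adj_def AH H1.carrier_scaleC H1.inner_scaleC_right H2.inner_scaleC_right)
  have "csubspace D"
    by (rule CV.subspaceI)
      (auto simp: D_def H2.carrier_zero H2.carrier_add H2.carrier_scaleC
        intro: adj0 adj_add adj_scale)
  moreover have "S \<subseteq> D" using SH adj unfolding D_def adj_def by blast
  ultimately have span_D: "cspan S \<subseteq> D" by (intro CV.span_minimal)
  define Y where "Y = {y. \<exists>f\<in>hcarrier H2. hnorm H2 f \<le> 1 \<and> adj f y}"
  have "\<exists>C. \<forall>y\<in>Y. hnorm H1 y \<le> C"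
  proof (rule H1.uniform_boundedness)
    show "Y \<subseteq> hcarrier H1" by (auto simp: Y_def adj_def)
    fix u assume u: "u \<in> hcarrier H1"
    have "cmod (hinner H1 u y) \<le> hnorm H2 (A u)" if "y \<in> Y" for y
    proof -
      obtain f where f: "f \<in> hcarrier H2" "hnorm H2 f \<le> 1" "adj f y"
        using \<open>y \<in> Y\<close> unfolding Y_def by blast
      moreover have "hinner H1 u y = hinner H2 (A u) f" using f(3) u by (simp add: adj_def)
      ultimately show ?thesis
        using H2.cauchy_schwarz[OF AH[OF u] f(1)] mult_left_mono[OF f(2) H2.hnorm_nonneg[OF AH[OF u]]]
        by simp
    qed
    then show "\<exists>C. \<forall>y\<in>Y. cmod (hinner H1 u y) \<le> C" by blast
  qed
  then obtain C0 where C0: "\<And>y. y \<in> Y \<Longrightarrow> hnorm H1 y \<le> C0" by blast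
  define C where "C = \<bar>C0\<bar>"
  have C: "C \<ge> 0" "\<And>y. y \<in> Y \<Longrightarrow> hnorm H1 y \<le> C" using C0 by (force simp: C_def)+
  have D_bound: "cmod (hinner H2 (A u) f) \<le> C * hnorm H1 u * hnorm H2 f"
    if u: "u \<in> hcarrier H1" and f: "f \<in> D" for u f
  proof (cases "f = 0")
    case True
    then show ?thesis using AH[OF u] H2.hnorm_zero by (simp add: H2.inner_zero_right)
  next
    case False
    have fH: "f \<in> hcarrier H2" using f by (simp add: D_def)
    obtain y where y: "adj f y" using f by (auto simp: D_def)
    then have yH: "y \<in> hcarrier H1" by (simp add: adj_def)
    have n: "hnorm H2 f > 0" using False H2.hnorm_eq_0[OF fH] H2.hnorm_nonneg[OF fH] by simp
    define a where "a = complex_of_real (inverse (hnorm H2 f))"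
    have a: "cmod a = inverse (hnorm H2 f)" using n by (simp add: a_def norm_inverse)
    have "hnorm H2 (a *\<^sub>C f) \<le> 1" using n by (simp add: H2.hnorm_scaleC[OF fH] a)
    then have "a *\<^sub>C y \<in> Y"
      using adj_scale[OF y fH] H2.carrier_scaleC[OF fH] by (auto simp: Y_def)
    then have "inverse (hnorm H2 f) * hnorm H1 y \<le> C"
      using C(2) H1.hnorm_scaleC[OF yH, of a] a by force
    then have "hnorm H1 y \<le> C * hnorm H2 f" using n by (simp add: field_simps)
    then have "hnorm H1 u * hnorm H1 y \<le> hnorm H1 u * (C * hnorm H2 f)"
      using H1.hnorm_nonneg[OF u] by (rule mult_left_mono)
    then show ?thesis
      using H1.cauchy_schwarz[OF u yH] y u by (simp add: adj_def mult.commute mult.left_commute)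
  qed
  \<comment> \<open>Test v = A u against an \<open>f\<close> in the span with |v - f| < |v| / 2, so
    |f| <= 3/2 |v|. Then |v|^2 <= 3/2 C |u| |v| + |v|^2 / 2, and absorbing the last term yields the
    factor 3.\<close>
  have "hnorm H2 (A u) \<le> 3 * C * hnorm H1 u" if u: "u \<in> hcarrier H1" for u
  proof (cases "hnorm H2 (A u) = 0")
    case True
    then show ?thesis using C(1) H1.hnorm_nonneg[OF u] by simp
  next
    case False
    define v where "v = A u"
    have v: "v \<in> hcarrier H2" using AH[OF u] by (simp add: v_def)
    have vpos: "hnorm H2 v > 0" using False H2.hnorm_nonneg[OF v] by (simp add: v_def)
    then obtain f where f: "f \<in> cspan S" "hnorm H2 (v - f) < hnorm H2 v / 2"
      using S v by (auto simp: hdense_span_def dest!: bspec[where x = v] spec[where x = "hnorm H2 v / 2"])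
    have fD: "f \<in> D" using f(1) span_D by blast
    then have fH: "f \<in> hcarrier H2" by (simp add: D_def)
    have vf: "v - f \<in> hcarrier H2" using v fH H2.carrier_diff by simp
    have nf: "hnorm H2 f \<le> 3/2 * hnorm H2 v"
      using H2.hnorm_le_diff[OF fH v] H2.hnorm_minus_commute[OF v fH] f(2) by simp
    have "cmod (hinner H2 v v) = (hnorm H2 v)\<^sup>2"
      by (simp add: H2.inner_self[OF v] norm_power)
    moreover have "hinner H2 v v = hinner H2 v f + hinner H2 v (v - f)"
      using H2.inner_diff_right[OF v fH v] by simp
    ultimately have "(hnorm H2 v)\<^sup>2 \<le> cmod (hinner H2 v f) + cmod (hinner H2 v (v - f))"
      by (metis norm_triangle_ineq)
    also have "cmod (hinner H2 v f) \<le> C * hnorm H1 u * (3/2 * hnorm H2 v)"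
      using D_bound[OF u fD] mult_left_mono[OF nf, of "C * hnorm H1 u"] C(1) H1.hnorm_nonneg[OF u]
      by (simp add: v_def)
    also have "cmod (hinner H2 v (v - f)) \<le> hnorm H2 v * (hnorm H2 v / 2)"
      using H2.cauchy_schwarz[OF v vf] mult_left_mono[OF less_imp_le[OF f(2)] H2.hnorm_nonneg[OF v]]
      by linarith
    finally have "hnorm H2 v * hnorm H2 v \<le> 3 * C * hnorm H1 u * hnorm H2 v"
      by (simp add: power2_eq_square)
    then show ?thesis using vpos by (simp add: v_def)
  qed
  with A show ?thesis unfolding hbounded_def by blast
qed

section \<open>Adjoints of bounded operators between spaces with carrier\<close>

lemma hadj_eqI:
  assumes "pre_hilbert H1" "x \<in> hcarrier H1"
    and "\<And>u. u \<in> hcarrier H1 \<Longrightarrow> hinner H2 (A u) y = hinner H1 u x"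
  shows "hadj H1 H2 A y = x"
  unfolding hadj_def using assms
  by (intro the_equality) (auto intro!: pre_hilbert.inner_eqI[OF assms(1)])

text \<open>Riesz representation of the functional u -> <A u, y>, whose bound comes from
  Cauchy-Schwarz and the boundedness of \<open>A\<close>. From here on the description in
  \<open>hadj\<close> can be used through its defining identity.\<close>

lemma
  assumes "hilbert H1" "pre_hilbert H2" "hbounded H1 H2 A" "y \<in> hcarrier H2"
  shows hadj_carrier: "hadj H1 H2 A y \<in> hcarrier H1"
    and hinner_hadj: "u \<in> hcarrier H1 \<Longrightarrow> hinner H2 (A u) y = hinner H1 u (hadj H1 H2 A y)"
proof -
  interpret H1: hilbert H1 by fact
  interpret H2: pre_hilbert H2 by fact
  note A = hlinearD[OF hbounded_hlinear[OF assms(3)]]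
  obtain C where C: "\<And>x. x \<in> hcarrier H1 \<Longrightarrow> hnorm H2 (A x) \<le> C * hnorm H1 x"
    using assms(3) by (auto simp: hbounded_def)
  obtain x where x: "x \<in> hcarrier H1" "\<And>u. u \<in> hcarrier H1 \<Longrightarrow> hinner H2 (A u) y = hinner H1 u x"
  proof (rule H1.riesz[of "\<lambda>u. hinner H2 (A u) y" "C * hnorm H2 y"])
    show "cmod (hinner H2 (A u) y) \<le> C * hnorm H2 y * hnorm H1 u" if "u \<in> hcarrier H1" for u
      using H2.cauchy_schwarz[OF A(1)[OF that] assms(4)]
        mult_right_mono[OF C[OF that] H2.hnorm_nonneg[OF assms(4)]]
      by (simp add: mult.commute mult.left_commute)
  qed (simp_all add: A assms(4) H2.inner_add_left H2.inner_scaleC_left)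
  have "hadj H1 H2 A y = x"
    by (rule hadj_eqI) (use x H1.pre_hilbert_axioms in auto)
  with x show "hadj H1 H2 A y \<in> hcarrier H1"
    "u \<in> hcarrier H1 \<Longrightarrow> hinner H2 (A u) y = hinner H1 u (hadj H1 H2 A y)" by auto
qed

text \<open>For x the adjoint vector of \<open>y\<close>, |x|^2 = <A x, y> <= C |x| |y|; cancelling
  |x| keeps the constant of \<open>A\<close>.\<close>

lemma hbounded_hadj:
  assumes "hilbert H1" "pre_hilbert H2" "hbounded H1 H2 A"
  shows "hbounded H2 H1 (hadj H1 H2 A)"
proof -
  interpret H1: hilbert H1 by fact
  interpret H2: pre_hilbert H2 by fact
  note A = hlinearD[OF hbounded_hlinear[OF assms(3)]]
  note adj = hadj_carrier[OF assms] and inner = hinner_hadj[OF assms]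
  obtain C where C: "C \<ge> 0" "\<And>x. x \<in> hcarrier H1 \<Longrightarrow> hnorm H2 (A x) \<le> C * hnorm H1 x"
    using hbounded_bound[OF assms(3) H1.pre_hilbert_axioms] by blast
  have "hlinear H2 H1 (hadj H1 H2 A)"
    unfolding hlinear_def
  proof (intro conjI ballI allI adj)
    fix x y assume xy: "x \<in> hcarrier H2" "y \<in> hcarrier H2"
    show "hadj H1 H2 A (x + y) = hadj H1 H2 A x + hadj H1 H2 A y"
      using xy H1.pre_hilbert_axioms by (intro hadj_eqI)
        (simp_all add: adj A H1.carrier_add H2.inner_add_right H1.inner_add_right inner)
  next
    fix c x assume x: "x \<in> hcarrier H2"
    show "hadj H1 H2 A (c *\<^sub>C x) = c *\<^sub>C hadj H1 H2 A x"
      using x H1.pre_hilbert_axioms by (intro hadj_eqI)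
        (simp_all add: adj A H1.carrier_scaleC H2.inner_scaleC_right H1.inner_scaleC_right inner)
  qed
  moreover have "hnorm H1 (hadj H1 H2 A y) \<le> C * hnorm H2 y" if y: "y \<in> hcarrier H2" for y
  proof -
    define x where "x = hadj H1 H2 A y"
    have x: "x \<in> hcarrier H1" using adj[OF y] by (simp add: x_def)
    have "complex_of_real ((hnorm H1 x)\<^sup>2) = hinner H2 (A x) y"
      using inner[OF y x] H1.inner_self[OF x] by (simp add: x_def)
    then have "(hnorm H1 x)\<^sup>2 = cmod (hinner H2 (A x) y)"
      by (metis abs_of_nonneg norm_of_real zero_le_power2)
    also have "\<dots> \<le> C * hnorm H1 x * hnorm H2 y"
      using H2.cauchy_schwarz[OF A(1)[OF x] y] mult_right_mono[OF C(2)[OF x] H2.hnorm_nonneg[OF y]]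
      by linarith
    finally have le: "hnorm H1 x * hnorm H1 x \<le> (C * hnorm H2 y) * hnorm H1 x"
      by (simp add: power2_eq_square mult.commute mult.left_commute)
    show ?thesis
    proof (cases "hnorm H1 x = 0")
      case True
      then show ?thesis using C(1) H2.hnorm_nonneg[OF y] by (simp add: x_def)
    next
      case False
      then have "hnorm H1 x > 0" using H1.hnorm_nonneg[OF x] by simp
      with le show ?thesis by (simp add: x_def)
    qed
  qed
  ultimately show ?thesis unfolding hbounded_def by blast
qed

section \<open>Tensor products\<close>

lemma hcarrier_type_hspace [simp]: "hcarrier type_hspace = UNIV"
  and hinner_type_hspace [simp]: "hinner type_hspace = cinner"
  and hnorm_type_hspace [simp]: "hnorm type_hspace x = norm x"
  by (simp_all add: type_hspace_def hnorm_def norm_eq_sqrt_cinner)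

lemma pre_hilbert_type_hspace: "pre_hilbert (type_hspace :: 'a::chilbert_space hspace)"
  using hilbert_type_hspace by (rule hilbert.axioms)

text \<open>Viewing u -> <u, x> as an operator into the scalars makes
  \<open>hbounded_eq_on_dense\<close> applicable to identities between inner products.\<close>

lemma (in pre_hilbert) hbounded_inner:
  assumes "x \<in> hcarrier H"
  shows "hbounded H (type_hspace :: complex hspace) (\<lambda>u. hinner H u x)"
  unfolding hbounded_def hlinear_def using assms cauchy_schwarz[OF _ assms]
  by (auto simp: inner_add_left inner_scaleC_left scaleC_complex_def mult.commute
      intro!: exI[of _ "hnorm H x"])

lemma (in pre_hilbert) inner_eq_on_dense:
  assumes "hdense_span H S" "x \<in> hcarrier H" "y \<in> hcarrier H"
    and "\<And>s. s \<in> S \<Longrightarrow> hinner H s x = hinner H s y"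
  shows "x = y"
  by (rule inner_eqI[OF assms(2,3)])
    (rule hbounded_eq_on_dense[OF hbounded_inner[OF assms(2)] hbounded_inner[OF assms(3)]
      pre_hilbert_axioms pre_hilbert_type_hspace assms(1,4)])

context hilbert_tensor
begin

lemma tensor_carrier: "\<lbrakk>x \<in> hcarrier H1; y \<in> hcarrier H2\<rbrakk> \<Longrightarrow> \<tau> x y \<in> hcarrier T"
  using hlinearD(1)[OF linear_left] .

lemma hnorm_tensor:
  assumes "x \<in> hcarrier H1" "y \<in> hcarrier H2"
  shows "hnorm T (\<tau> x y) = hnorm H1 x * hnorm H2 y"
proof -
  have "complex_of_real ((hnorm T (\<tau> x y))\<^sup>2) = complex_of_real ((hnorm H1 x * hnorm H2 y)\<^sup>2)"
    using inner_tensor[OF assms assms]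
    by (simp add: T.inner_self[OF tensor_carrier] H1.inner_self H2.inner_self assms power_mult_distrib)
  then have "(hnorm T (\<tau> x y))\<^sup>2 = (hnorm H1 x * hnorm H2 y)\<^sup>2" using of_real_eq_iff by blast
  then show ?thesis
    using T.hnorm_nonneg[OF tensor_carrier] H1.hnorm_nonneg H2.hnorm_nonneg assms
    by (simp add: power2_eq_iff_nonneg)
qed

lemma hbounded_tensor_left:
  assumes "y \<in> hcarrier H2"
  shows "hbounded H1 T (\<lambda>x. \<tau> x y)"
  unfolding hbounded_def using linear_left assms hnorm_tensor
  by (auto simp: mult.commute intro!: exI[of _ "hnorm H2 y"])

lemma hbounded_tensor_right:
  assumes "x \<in> hcarrier H1"
  shows "hbounded H2 T (\<lambda>y. \<tau> x y)"
  unfolding hbounded_def using linear_right assms hnorm_tensor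
  by (auto intro!: exI[of _ "hnorm H1 x"])

lemma tensor_eqI:
  assumes "t \<in> hcarrier T" "t' \<in> hcarrier T"
    and "\<And>x y. \<lbrakk>x \<in> hcarrier H1; y \<in> hcarrier H2\<rbrakk> \<Longrightarrow> hinner T (\<tau> x y) t = hinner T (\<tau> x y) t'"
  shows "t = t'"
  by (rule T.inner_eq_on_dense[OF total assms(1,2)]) (use assms(3) in auto)

text \<open>Every element of the algebraic tensor product is a sum of elementary tensors with
  pairwise orthogonal second factors, so that its norm can be read off from the first factors.
  Zero vectors are allowed, which avoids a case distinction in the Gram--Schmidt step.\<close>

definition orth_graph :: "('a \<Rightarrow> 'a) \<Rightarrow> ('t \<times> 't) set"
  where "orth_graph A = {(\<Sum>i<n. \<tau> (x i) (b i), \<Sum>i<n. \<tau> (A (x i)) (b i)) | (n::nat) x b.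
    (\<forall>i<n. x i \<in> hcarrier H1 \<and> b i \<in> hcarrier H2) \<and>
    (\<forall>i<n. \<forall>j<n. i \<noteq> j \<longrightarrow> hinner H2 (b i) (b j) = 0)}"

lemma orth_graphI:
  fixes n :: nat
  assumes "\<And>i. i < n \<Longrightarrow> x i \<in> hcarrier H1" "\<And>i. i < n \<Longrightarrow> b i \<in> hcarrier H2"
    and "\<And>i j. \<lbrakk>i < n; j < n; i \<noteq> j\<rbrakk> \<Longrightarrow> hinner H2 (b i) (b j) = 0"
    and "s = (\<Sum>i<n. \<tau> (x i) (b i))" "r = (\<Sum>i<n. \<tau> (A (x i)) (b i))"
  shows "(s, r) \<in> orth_graph A"
  unfolding orth_graph_def mem_Collect_eq
  by (intro exI[of _ n] exI[of _ x] exI[of _ b]) (use assms in auto)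

lemma orth_graphE:
  assumes "(s, r) \<in> orth_graph A"
  obtains n :: nat and x b where "\<And>i. i < n \<Longrightarrow> x i \<in> hcarrier H1" "\<And>i. i < n \<Longrightarrow> b i \<in> hcarrier H2"
    "\<And>i j. \<lbrakk>i < n; j < n; i \<noteq> j\<rbrakk> \<Longrightarrow> hinner H2 (b i) (b j) = 0"
    "s = (\<Sum>i<n. \<tau> (x i) (b i))" "r = (\<Sum>i<n. \<tau> (A (x i)) (b i))"
  using assms unfolding orth_graph_def
  by (elim CollectE exE conjE Pair_inject) (rule that, auto)

text \<open>Pythagoras: every off-diagonal term of the double sum contains a factor <b i, b j> = 0,
  while the \<open>x i\<close> remain arbitrary.\<close>

lemma hnorm_orth_sum:
  fixes n :: nat
  assumes x: "\<And>i. i < n \<Longrightarrow> x i \<in> hcarrier H1" and b: "\<And>i. i < n \<Longrightarrow> b i \<in> hcarrier H2"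
    and orth: "\<And>i j. \<lbrakk>i < n; j < n; i \<noteq> j\<rbrakk> \<Longrightarrow> hinner H2 (b i) (b j) = 0"
  shows "(hnorm T (\<Sum>i<n. \<tau> (x i) (b i)))\<^sup>2 = (\<Sum>i<n. (hnorm H1 (x i))\<^sup>2 * (hnorm H2 (b i))\<^sup>2)"
proof -
  define s where "s = (\<Sum>i<n. \<tau> (x i) (b i))"
  have c: "\<tau> (x i) (b i) \<in> hcarrier T" if "i \<in> {..<n}" for i
    using that x b tensor_carrier by simp
  have s: "s \<in> hcarrier T" unfolding s_def using c by (rule T.carrier_sum)
  have "hinner T (\<Sum>i<n. \<tau> (x i) (b i)) s = (\<Sum>i<n. hinner T (\<tau> (x i) (b i)) s)"
    by (rule T.inner_sum_left[OF c s])
  also have "\<dots> = (\<Sum>i<n. \<Sum>j<n. hinner T (\<tau> (x i) (b i)) (\<tau> (x j) (b j)))"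
    unfolding s_def by (intro sum.cong T.inner_sum_right c refl)
  also have "\<dots> = (\<Sum>i<n. \<Sum>j<n. if i = j then complex_of_real ((hnorm H1 (x i))\<^sup>2 * (hnorm H2 (b i))\<^sup>2) else 0)"
    using x b orth by (intro sum.cong) (auto simp: inner_tensor H1.inner_self H2.inner_self)
  also have "\<dots> = complex_of_real (\<Sum>i<n. (hnorm H1 (x i))\<^sup>2 * (hnorm H2 (b i))\<^sup>2)"
    by simp
  finally have "complex_of_real ((hnorm T s)\<^sup>2)
      = complex_of_real (\<Sum>i<n. (hnorm H1 (x i))\<^sup>2 * (hnorm H2 (b i))\<^sup>2)"
    by (simp only: T.inner_self[OF s] s_def[symmetric])
  then show ?thesis unfolding s_def using of_real_eq_iff by blast
qed

text \<open>Both squared norms are sums with the same weights |b i|^2, so the bound for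
  \<open>A\<close> applies term by term. In particular s = 0 forces r = 0, which is the
  well-definedness that arbitrary representations hide.\<close>

lemma orth_graph_bound:
  assumes A: "\<And>x. x \<in> hcarrier H1 \<Longrightarrow> A x \<in> hcarrier H1" and "C \<ge> 0"
    and C: "\<And>x. x \<in> hcarrier H1 \<Longrightarrow> hnorm H1 (A x) \<le> C * hnorm H1 x"
    and sr: "(s, r) \<in> orth_graph A"
  shows "s \<in> hcarrier T" "r \<in> hcarrier T" "hnorm T r \<le> C * hnorm T s"
proof -
  obtain n :: nat and x b where x: "\<And>i. i < n \<Longrightarrow> x i \<in> hcarrier H1" and b: "\<And>i. i < n \<Longrightarrow> b i \<in> hcarrier H2"
    and orth: "\<And>i j. \<lbrakk>i < n; j < n; i \<noteq> j\<rbrakk> \<Longrightarrow> hinner H2 (b i) (b j) = 0"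
    and s: "s = (\<Sum>i<n. \<tau> (x i) (b i))" and r: "r = (\<Sum>i<n. \<tau> (A (x i)) (b i))"
    using sr by (rule orth_graphE) blast
  show sT: "s \<in> hcarrier T" and "r \<in> hcarrier T"
    unfolding s r using x b A by (auto intro!: T.carrier_sum tensor_carrier)
  have "(hnorm T r)\<^sup>2 = (\<Sum>i<n. (hnorm H1 (A (x i)))\<^sup>2 * (hnorm H2 (b i))\<^sup>2)"
    unfolding r by (rule hnorm_orth_sum) (use x b A orth in auto)
  also have "\<dots> \<le> (\<Sum>i<n. (C * hnorm H1 (x i))\<^sup>2 * (hnorm H2 (b i))\<^sup>2)"
    using C x A H1.hnorm_nonneg by (intro sum_mono mult_right_mono power_mono) auto
  also have "\<dots> = (C * hnorm T s)\<^sup>2"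
    unfolding s by (subst power_mult_distrib, subst hnorm_orth_sum)
      (use x b orth in \<open>auto simp: power_mult_distrib sum_distrib_left mult.assoc\<close>)
  finally show "hnorm T r \<le> C * hnorm T s"
    by (rule power2_le_imp_le) (use T.hnorm_nonneg[OF sT] \<open>C \<ge> 0\<close> in simp)
qed

text \<open>One Gram-Schmidt step. Split \<open>y\<close> into its projection \<open>q\<close> onto
  the span of the \<open>b i\<close> and the rest. The tensor of \<open>u\<close> with
  \<open>q\<close> is absorbed by replacing \<open>x i\<close> with
  \<open>x i + c i *\<^sub>C u\<close>; the tensor of \<open>u\<close> with \<open>y - q\<close>
  becomes a new summand. Linearity of \<open>A\<close> lets the second component follow with the
  same coefficients.\<close>

lemma orth_graph_insert:
  assumes A: "hlinear H1 H1 A" and sr: "(s, r) \<in> orth_graph A"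
    and u: "u \<in> hcarrier H1" and y: "y \<in> hcarrier H2"
  shows "(s + \<tau> u y, r + \<tau> (A u) y) \<in> orth_graph A"
proof -
  obtain n :: nat and x b where x: "\<And>i. i < n \<Longrightarrow> x i \<in> hcarrier H1" and b: "\<And>i. i < n \<Longrightarrow> b i \<in> hcarrier H2"
    and orth: "\<And>i j. \<lbrakk>i < n; j < n; i \<noteq> j\<rbrakk> \<Longrightarrow> hinner H2 (b i) (b j) = 0"
    and s: "s = (\<Sum>i<n. \<tau> (x i) (b i))" and r: "r = (\<Sum>i<n. \<tau> (A (x i)) (b i))"
    using sr by (rule orth_graphE) blast
  \<comment> \<open>For b i = 0 division by zero gives c i = 0, and the projection identity below
    still holds since both of its sides vanish.\<close>
  define c where "c i = hinner H2 y (b i) / hinner H2 (b i) (b i)" for i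
  define q where "q = (\<Sum>i<n. c i *\<^sub>C b i)"
  define b' where "b' i = (if i = n then y - q else b i)" for i
  define x' where "x' i = (if i = n then u else x i + c i *\<^sub>C u)" for i
  have cb: "c i *\<^sub>C b i \<in> hcarrier H2" if "i < n" for i using b[OF that] H2.carrier_scaleC by simp
  have q: "q \<in> hcarrier H2" unfolding q_def using cb by (auto intro: H2.carrier_sum)
  have yq: "y - q \<in> hcarrier H2" using y q H2.carrier_diff by simp
  have q_inner: "hinner H2 q (b j) = hinner H2 y (b j)" if j: "j < n" for j
  proof -
    have "hinner H2 q (b j) = (\<Sum>i<n. c i * hinner H2 (b i) (b j))"
      unfolding q_def
      by (subst H2.inner_sum_left) (auto intro!: sum.cong H2.inner_scaleC_left cb b j)
    also have "\<dots> = (\<Sum>i<n. if i = j then c j * hinner H2 (b j) (b j) else 0)"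
      by (rule sum.cong) (auto simp: orth[OF _ j])
    also have "\<dots> = c j * hinner H2 (b j) (b j)"
      using sum.delta[of "{..<n}" j "\<lambda>_. c j * hinner H2 (b j) (b j)"] j by simp
    also have "\<dots> = hinner H2 y (b j)"
      using H2.inner_self_eq_0[OF b[OF j]] H2.inner_zero_right[OF y] by (auto simp: c_def)
    finally show ?thesis .
  qed
  have yq_orth: "hinner H2 (y - q) (b j) = 0" "hinner H2 (b j) (y - q) = 0" if "j < n" for j
    using q_inner[OF that] H2.inner_diff_left[OF y q b[OF that]] H2.inner_commute[OF b[OF that] yq]
    by simp_all
  \<comment> \<open>Stated for general \<open>v\<close> and \<open>w\<close> because it is applied
    twice: to \<open>x\<close>, \<open>u\<close> for the first component and to their images under
    \<open>A\<close> for the second.\<close>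
  have split: "(\<Sum>i<n. \<tau> (v i + c i *\<^sub>C w) (b i)) + \<tau> w (y - q) = (\<Sum>i<n. \<tau> (v i) (b i)) + \<tau> w y"
    if v: "\<And>i. i < n \<Longrightarrow> v i \<in> hcarrier H1" and w: "w \<in> hcarrier H1" for v w
  proof -
    have "\<tau> (v i + c i *\<^sub>C w) (b i) = \<tau> (v i) (b i) + \<tau> w (c i *\<^sub>C b i)" if "i < n" for i
      using hlinearD[OF linear_left[OF b[OF that]]] hlinearD(3)[OF linear_right[OF w] b[OF that]]
        v[OF that] w H1.carrier_scaleC by simp
    then have "(\<Sum>i<n. \<tau> (v i + c i *\<^sub>C w) (b i)) = (\<Sum>i<n. \<tau> (v i) (b i)) + (\<Sum>i<n. \<tau> w (c i *\<^sub>C b i))"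
      by (simp add: sum.distrib)
    moreover have "(\<Sum>i\<in>I. \<tau> w (c i *\<^sub>C b i)) = \<tau> w (\<Sum>i\<in>I. c i *\<^sub>C b i)" if "I \<subseteq> {..<n}" for I
      using finite_subset[OF that finite_lessThan] that
    proof (induction I rule: finite_induct)
      case empty
      then show ?case
        using hlinear_diff[OF linear_right[OF w] H2.pre_hilbert_axioms y y] by simp
    next
      case (insert i I)
      then have "(\<Sum>i\<in>I. c i *\<^sub>C b i) \<in> hcarrier H2" using cb by (intro H2.carrier_sum) auto
      then show ?case
        using insert.hyps insert.IH insert.prems
          hlinearD(2)[OF linear_right[OF w] cb, of i "\<Sum>i\<in>I. c i *\<^sub>C b i"] by simp
    qed
    then have "(\<Sum>i<n. \<tau> w (c i *\<^sub>C b i)) = \<tau> w q" unfolding q_def by blast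
    moreover have "\<tau> w (y - q) = \<tau> w y - \<tau> w q"
      by (rule hlinear_diff[OF linear_right[OF w] H2.pre_hilbert_axioms y q])
    ultimately show ?thesis by simp
  qed
  show ?thesis
  proof (rule orth_graphI[of "Suc n" x' b'])
    show "x' i \<in> hcarrier H1" if "i < Suc n" for i
      using that x u H1.carrier_add H1.carrier_scaleC by (simp add: x'_def)
    show "b' i \<in> hcarrier H2" if "i < Suc n" for i
      using that b yq by (simp add: b'_def)
    show "hinner H2 (b' i) (b' j) = 0" if "i < Suc n" "j < Suc n" "i \<noteq> j" for i j
      using that orth yq_orth by (auto simp: b'_def)
    show "s + \<tau> u y = (\<Sum>i<Suc n. \<tau> (x' i) (b' i))"
      using split[OF x u] by (simp add: s x'_def b'_def)
    have "(\<Sum>i<n. \<tau> (A (x i + c i *\<^sub>C u)) (b i)) = (\<Sum>i<n. \<tau> (A (x i) + c i *\<^sub>C A u) (b i))"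
      using x u H1.carrier_scaleC hlinearD[OF A] by simp
    then show "r + \<tau> (A u) y = (\<Sum>i<Suc n. \<tau> (A (x' i)) (b' i))"
      using split[of "\<lambda>i. A (x i)" "A u"] x u hlinearD(1)[OF A] by (simp add: r x'_def b'_def)
  qed
qed

lemma orth_graph_zero: "(0, 0) \<in> orth_graph A"
  by (rule orth_graphI[of 0]) auto

text \<open>Concatenating two orthogonal families does not give an orthogonal one, so the summands
  of the second are inserted one at a time, each insertion orthogonalising again.\<close>

lemma orth_graph_add:
  assumes A: "hlinear H1 H1 A" and sr: "(s, r) \<in> orth_graph A" and sr': "(s', r') \<in> orth_graph A"
  shows "(s + s', r + r') \<in> orth_graph A"
proof -
  obtain n :: nat and x b where x: "\<And>i. i < n \<Longrightarrow> x i \<in> hcarrier H1" and b: "\<And>i. i < n \<Longrightarrow> b i \<in> hcarrier H2"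
    and s': "s' = (\<Sum>i<n. \<tau> (x i) (b i))" and r': "r' = (\<Sum>i<n. \<tau> (A (x i)) (b i))"
    using sr' by (rule orth_graphE) blast
  have "(s + (\<Sum>i<m. \<tau> (x i) (b i)), r + (\<Sum>i<m. \<tau> (A (x i)) (b i))) \<in> orth_graph A" if "m \<le> n" for m
    using that
  proof (induction m)
    case (Suc m)
    then show ?case
      using orth_graph_insert[OF A Suc.IH[OF Suc_leD[OF Suc.prems]] x[of m] b[of m]]
      by (simp add: add.assoc)
  qed (simp add: sr)
  then show ?thesis by (simp add: s' r')
qed

lemma orth_graph_scale:
  assumes A: "hlinear H1 H1 A" and sr: "(s, r) \<in> orth_graph A"
  shows "(a *\<^sub>C s, a *\<^sub>C r) \<in> orth_graph A"
proof -
  obtain n :: nat and x b where x: "\<And>i. i < n \<Longrightarrow> x i \<in> hcarrier H1" and b: "\<And>i. i < n \<Longrightarrow> b i \<in> hcarrier H2"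
    and orth: "\<And>i j. \<lbrakk>i < n; j < n; i \<noteq> j\<rbrakk> \<Longrightarrow> hinner H2 (b i) (b j) = 0"
    and s: "s = (\<Sum>i<n. \<tau> (x i) (b i))" and r: "r = (\<Sum>i<n. \<tau> (A (x i)) (b i))"
    using sr by (rule orth_graphE) blast
  note lin = hlinearD(3)[OF linear_left[OF b]]
  show ?thesis
  proof (rule orth_graphI[of n "\<lambda>i. a *\<^sub>C x i" b])
    show "a *\<^sub>C s = (\<Sum>i<n. \<tau> (a *\<^sub>C x i) (b i))"
      unfolding s CV.scale_sum_right using x lin by (intro sum.cong) auto
    show "a *\<^sub>C r = (\<Sum>i<n. \<tau> (A (a *\<^sub>C x i)) (b i))"
      unfolding r CV.scale_sum_right using x lin hlinearD[OF A] by (intro sum.cong) auto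
  qed (use x b orth H1.carrier_scaleC in auto)
qed

lemma orth_graph_tensor:
  assumes "hlinear H1 H1 A" "x \<in> hcarrier H1" "y \<in> hcarrier H2"
  shows "(\<tau> x y, \<tau> (A x) y) \<in> orth_graph A"
  using orth_graph_insert[OF assms(1) orth_graph_zero assms(2,3)] by simp

text \<open>\<open>orth_graph A\<close> is a bounded linear relation whose domain contains the span
  of the elementary tensors, so it extends to \<open>T\<close>. Two candidates agree on
  \<open>T\<close> by totality and elsewhere by the prescribed value 0.\<close>

lemma tensor_op_exists:
  assumes A: "hbounded H1 H1 A"
  shows "\<exists>!C. hbounded T T C \<and> (\<forall>t. t \<notin> hcarrier T \<longrightarrow> C t = 0) \<and>
    (\<forall>x\<in>hcarrier H1. \<forall>y\<in>hcarrier H2. C (\<tau> x y) = \<tau> (A x) y)"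
proof (rule ex_ex1I)
  note lin = hbounded_hlinear[OF A]
  obtain c where c: "c \<ge> 0" "\<And>x. x \<in> hcarrier H1 \<Longrightarrow> hnorm H1 (A x) \<le> c * hnorm H1 x"
    using hbounded_bound[OF A H1.pre_hilbert_axioms] by blast
  note bound = orth_graph_bound[OF hlinearD(1)[OF lin] c]
  let ?S = "{\<tau> x y | x y. x \<in> hcarrier H1 \<and> y \<in> hcarrier H2}"
  have "csubspace (fst ` orth_graph A)"
  proof (rule CV.subspaceI)
    show "0 \<in> fst ` orth_graph A" using orth_graph_zero by force
    show "x + y \<in> fst ` orth_graph A" if "x \<in> fst ` orth_graph A" "y \<in> fst ` orth_graph A" for x y
      using that orth_graph_add[OF lin] by force
    show "a *\<^sub>C x \<in> fst ` orth_graph A" if "x \<in> fst ` orth_graph A" for a x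
      using that orth_graph_scale[OF lin] by force
  qed
  moreover have "?S \<subseteq> fst ` orth_graph A" using orth_graph_tensor[OF lin] by force
  ultimately have span: "cspan ?S \<subseteq> fst ` orth_graph A" by (intro CV.span_minimal)
  obtain C where C: "hlinear T T C" "\<And>s r. (s, r) \<in> orth_graph A \<Longrightarrow> C s = r"
    "\<And>x. x \<in> hcarrier T \<Longrightarrow> hnorm T (C x) \<le> c * hnorm T x"
  proof (rule bounded_extension[OF T.pre_hilbert_axioms T.hilbert_axioms, of "orth_graph A" c])
    show "orth_graph A \<subseteq> hcarrier T \<times> hcarrier T" using bound(1,2) by auto
    fix x and e :: real assume "x \<in> hcarrier T" "e > 0"
    then obtain s where "s \<in> cspan ?S" "hnorm T (x - s) < e"
      using total unfolding hdense_span_def by blast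
    then show "\<exists>(s, r)\<in>orth_graph A. hnorm T (x - s) < e" using span by force
  qed (use orth_graph_add[OF lin] orth_graph_scale[OF lin] bound(3) c(1) in auto)
  define C' where "C' t = (if t \<in> hcarrier T then C t else 0)" for t
  have C'_eq: "C' t = C t" if "t \<in> hcarrier T" for t using that by (simp add: C'_def)
  have "hlinear T T C'"
    using C(1) T.carrier_add T.carrier_scaleC unfolding hlinear_def by (simp add: C'_eq)
  then have "hbounded T T C'"
    unfolding hbounded_def using C(3) by (auto simp: C'_eq)
  moreover have "\<forall>x\<in>hcarrier H1. \<forall>y\<in>hcarrier H2. C' (\<tau> x y) = \<tau> (A x) y"
    using C(2)[OF orth_graph_tensor[OF lin]] tensor_carrier by (simp add: C'_eq)
  ultimately show "\<exists>C. hbounded T T C \<and> (\<forall>t. t \<notin> hcarrier T \<longrightarrow> C t = 0) \<and>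
    (\<forall>x\<in>hcarrier H1. \<forall>y\<in>hcarrier H2. C (\<tau> x y) = \<tau> (A x) y)"
    by (intro exI[of _ C']) (simp add: C'_def)
next
  fix C C'
  assume C: "hbounded T T C \<and> (\<forall>t. t \<notin> hcarrier T \<longrightarrow> C t = 0) \<and>
      (\<forall>x\<in>hcarrier H1. \<forall>y\<in>hcarrier H2. C (\<tau> x y) = \<tau> (A x) y)"
    and C': "hbounded T T C' \<and> (\<forall>t. t \<notin> hcarrier T \<longrightarrow> C' t = 0) \<and>
      (\<forall>x\<in>hcarrier H1. \<forall>y\<in>hcarrier H2. C' (\<tau> x y) = \<tau> (A x) y)"
  have "C t = C' t" for t
  proof (cases "t \<in> hcarrier T")
    case True
    show ?thesis
      by (rule hbounded_eq_on_dense[OF _ _ T.pre_hilbert_axioms T.pre_hilbert_axioms total _ True])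
        (use C C' in auto)
  next
    case False
    then show ?thesis using C C' by simp
  qed
  then show "C = C'" by blast
qed

lemma
  assumes "hbounded H1 H1 A"
  shows hbounded_tensor_op: "hbounded T T (tensor_op H1 H2 T \<tau> A (\<lambda>y. y))"
    and tensor_op_tensor: "\<lbrakk>x \<in> hcarrier H1; y \<in> hcarrier H2\<rbrakk>
      \<Longrightarrow> tensor_op H1 H2 T \<tau> A (\<lambda>y. y) (\<tau> x y) = \<tau> (A x) y"
proof -
  define C where "C = tensor_op H1 H2 T \<tau> A (\<lambda>y. y)"
  have C: "hbounded T T C \<and> (\<forall>t. t \<notin> hcarrier T \<longrightarrow> C t = 0) \<and>
      (\<forall>x\<in>hcarrier H1. \<forall>y\<in>hcarrier H2. C (\<tau> x y) = \<tau> (A x) y)"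
    unfolding C_def tensor_op_def by (rule theI'[OF tensor_op_exists[OF assms]])
  show "hbounded T T (tensor_op H1 H2 T \<tau> A (\<lambda>y. y))"
    using C by (simp add: C_def[symmetric])
  show "tensor_op H1 H2 T \<tau> A (\<lambda>y. y) (\<tau> x y) = \<tau> (A x) y"
    if "x \<in> hcarrier H1" "y \<in> hcarrier H2"
    using C that by (simp add: C_def[symmetric])
qed

text \<open>This expresses that the adjoint of B tensored with I is the adjoint of \<open>B\<close>
  tensored with I, tested on one elementary tensor. With \<open>x\<close> and \<open>y\<close>
  fixed, both sides are conjugates of bounded linear functionals of \<open>t\<close>, so elementary
  \<open>t\<close> suffice, and there only the adjoint relation in \<open>H1\<close>
  remains.\<close>

lemma inner_tensor_op_hadj:
  assumes B: "hbounded H1 H1 B" and x: "x \<in> hcarrier H1" and y: "y \<in> hcarrier H2"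
    and t: "t \<in> hcarrier T"
  shows "hinner T (\<tau> (B x) y) t = hinner T (\<tau> x y) (tensor_op H1 H2 T \<tau> (hadj H1 H1 B) (\<lambda>y. y) t)"
proof -
  note adj = hbounded_hadj[OF H1.hilbert_axioms H1.pre_hilbert_axioms B]
  define C where "C = tensor_op H1 H2 T \<tau> (hadj H1 H1 B) (\<lambda>y. y)"
  have C: "hbounded T T C"
    unfolding C_def by (rule hbounded_tensor_op[OF adj])
  have C_tensor: "C (\<tau> x' y') = \<tau> (hadj H1 H1 B x') y'"
    if "x' \<in> hcarrier H1" "y' \<in> hcarrier H2" for x' y'
    unfolding C_def by (rule tensor_op_tensor[OF adj that])
  have Bx: "B x \<in> hcarrier H1" using hlinearD(1)[OF hbounded_hlinear[OF B] x] .
  have Ct: "C t \<in> hcarrier T" using hlinearD(1)[OF hbounded_hlinear[OF C] t] .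
  have "hinner T t (\<tau> (B x) y) = hinner T (C t) (\<tau> x y)"
  proof (rule hbounded_eq_on_dense[OF T.hbounded_inner
        hbounded_compose[OF C T.hbounded_inner T.pre_hilbert_axioms T.pre_hilbert_axioms]
        T.pre_hilbert_axioms pre_hilbert_type_hspace total _ t])
    fix s assume "s \<in> {\<tau> x y | x y. x \<in> hcarrier H1 \<and> y \<in> hcarrier H2}"
    then obtain x' y' where s: "s = \<tau> x' y'" and x': "x' \<in> hcarrier H1" and y': "y' \<in> hcarrier H2"
      by blast
    have adj_x': "hadj H1 H1 B x' \<in> hcarrier H1"
      using hlinearD(1)[OF hbounded_hlinear[OF adj] x'] .
    have "hinner H1 x' (B x) = hinner H1 (hadj H1 H1 B x') x"
      using hinner_hadj[OF H1.hilbert_axioms H1.pre_hilbert_axioms B x' x]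
        H1.inner_commute[OF x' Bx] H1.inner_commute[OF adj_x' x] by simp
    then show "hinner T s (\<tau> (B x) y) = hinner T (C s) (\<tau> x y)"
      using x y x' y' Bx adj_x' by (simp add: s C_tensor inner_tensor)
  qed (use x y Bx tensor_carrier in auto)
  then show ?thesis
    using T.inner_commute[OF t tensor_carrier[OF Bx y]] T.inner_commute[OF Ct tensor_carrier[OF x y]]
    by (simp add: C_def)
qed

text \<open>The slice \<open>s\<close> of \<open>t\<close> at \<open>y\<close>, given by \<open>\<langle>x \<otimes> y, t\<rangle> = \<langle>x, s\<rangle>\<close>, inherits the eigenvalue
  equations of \<open>t\<close> and is therefore a multiple of \<open>k\<close>.\<close>

lemma joint_eigenvector_elementary:
  assumes B: "\<And>i. hbounded H1 H1 (B i)" and k: "k \<in> hcarrier H1" "k \<noteq> 0"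
    and eig: "\<And>f. \<lbrakk>f \<in> hcarrier H1; \<And>i. hadj H1 H1 (B i) f = c i *\<^sub>C f\<rbrakk> \<Longrightarrow> \<exists>a. f = a *\<^sub>C k"
    and t: "t \<in> hcarrier T"
    and t_eig: "\<And>i. tensor_op H1 H2 T \<tau> (hadj H1 H1 (B i)) (\<lambda>y. y) t = c i *\<^sub>C t"
  shows "\<exists>y\<in>hcarrier H2. t = \<tau> k y"
proof -
  define n where "n = hinner H1 k k"
  have n: "n \<noteq> 0" using H1.inner_self_eq_0[OF k(1)] k(2) unfolding n_def by blast
  have cnj_n: "cnj n = n" unfolding n_def by (rule H1.inner_commute[OF k(1) k(1), symmetric])
  \<comment> \<open>If t = \<tau> k f, then pairing with \<tau> k y must give n <y, f>. This forces
    \<open>f\<close> to be the adjoint of \<tau> k at \<open>t\<close>, divided by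
    \<open>n\<close>.\<close>
  define f where "f = (1 / n) *\<^sub>C hadj H2 T (\<tau> k) t"
  have adj: "hadj H2 T (\<tau> k) t \<in> hcarrier H2"
    by (rule hadj_carrier[OF H2.hilbert_axioms T.pre_hilbert_axioms hbounded_tensor_right[OF k(1)] t])
  then have f: "f \<in> hcarrier H2" by (simp add: f_def H2.carrier_scaleC)
  have f_inner: "hinner T (\<tau> k y) t = n * hinner H2 y f" if y: "y \<in> hcarrier H2" for y
    using hinner_hadj[OF H2.hilbert_axioms T.pre_hilbert_axioms hbounded_tensor_right[OF k(1)] t y] n cnj_n
    by (simp add: f_def H2.inner_scaleC_right[OF adj y])
  have "t = \<tau> k f"
  proof (rule tensor_eqI[OF t tensor_carrier[OF k(1) f]])
    fix x y assume x: "x \<in> hcarrier H1" and y: "y \<in> hcarrier H2"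
    define s where "s = hadj H1 T (\<lambda>x. \<tau> x y) t"
    have s: "s \<in> hcarrier H1" unfolding s_def
      by (rule hadj_carrier[OF H1.hilbert_axioms T.pre_hilbert_axioms hbounded_tensor_left[OF y] t])
    have s_inner: "hinner T (\<tau> u y) t = hinner H1 u s" if "u \<in> hcarrier H1" for u
      unfolding s_def
      by (rule hinner_hadj[OF H1.hilbert_axioms T.pre_hilbert_axioms hbounded_tensor_left[OF y] t that])
    have "hadj H1 H1 (B i) s = c i *\<^sub>C s" for i
    proof (rule hadj_eqI[OF H1.pre_hilbert_axioms H1.carrier_scaleC[OF s]])
      fix u assume u: "u \<in> hcarrier H1"
      have "hinner H1 (B i u) s = hinner T (\<tau> (B i u) y) t"
        using s_inner hlinearD(1)[OF hbounded_hlinear[OF B] u] by simp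
      also have "\<dots> = hinner T (\<tau> u y) (c i *\<^sub>C t)"
        using inner_tensor_op_hadj[OF B u y t] t_eig by simp
      also have "\<dots> = hinner H1 u (c i *\<^sub>C s)"
        using s_inner[OF u] u y t s
        by (simp add: T.inner_scaleC_right tensor_carrier H1.inner_scaleC_right)
      finally show "hinner H1 (B i u) s = hinner H1 u (c i *\<^sub>C s)" .
    qed
    then obtain a where a: "s = a *\<^sub>C k" using eig[OF s] by blast
    \<comment> \<open>Evaluate the slice identity at u = k and compare it with the choice of
      \<open>f\<close>: both sides equal <\<tau> k y, t> up to the nonzero factor
      \<open>n\<close>.\<close>
    have "cnj a = hinner H2 y f"
      using f_inner[OF y] s_inner[OF k(1)] n
      by (simp add: a H1.inner_scaleC_right[OF k(1) k(1)] n_def)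
    then show "hinner T (\<tau> x y) t = hinner T (\<tau> x y) (\<tau> k f)"
      using s_inner[OF x] by (simp add: a H1.inner_scaleC_right[OF k(1) x] inner_tensor x y k(1) f)
  qed
  with f show ?thesis by blast
qed

end

section \<open>Holomorphic operator-valued functions\<close>

lemma norm_vector_smult: "norm (c *s (x :: complex ^ 'n)) = cmod c * norm x"
  by (simp add: norm_vec_def norm_mult L2_set_right_distrib)

lemma bounded_linear_vector_smult: "bounded_linear (\<lambda>c. c *s (x :: complex ^ 'n))"
  by (rule bounded_linear_intro[where K = "norm x"])
    (simp_all add: vec_eq_iff algebra_simps norm_vector_smult)

lemma cinner_Cauchy_Schwarz: "cmod (cinner x y) \<le> norm x * norm (y :: 'a::chilbert_space)"
  using pre_hilbert.cauchy_schwarz[OF pre_hilbert_type_hspace, of x y] by simp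

lemma cinner_norm_sq: "cinner x x = complex_of_real ((norm (x :: 'a::chilbert_space))\<^sup>2)"
  using pre_hilbert.inner_self[OF pre_hilbert_type_hspace, of x] by simp

lemma bounded_linear_cinner_left: "bounded_linear (\<lambda>x. cinner x (y :: 'a::chilbert_space))"
  by (rule bounded_linear_intro[where K = "norm y"])
    (simp_all add: cinner_add_left scaleR_scaleC cinner_scaleC_left cinner_Cauchy_Schwarz
      scaleC_complex_def)

text \<open>Turns scalar estimates into norm estimates: a bound for all pairings <x, y> is used at y
  = x, where one factor of the norm cancels.\<close>

lemma norm_le_if_cinner_le:
  assumes "cmod (cinner x x) \<le> B * norm (x :: 'a::chilbert_space)" "B \<ge> 0"
  shows "norm x \<le> B"
  using assms by (cases "x = 0") (simp_all add: cinner_norm_sq power2_eq_square norm_mult)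

text \<open>The constants come from Cauchy's estimate on discs of radius \<open>R/2\<close> around \<open>0\<close> and \<open>R/4\<close>
  around the points of \<open>ball 0 (R/2)\<close>.\<close>

lemma Taylor_remainder_unit:
  assumes f: "f holomorphic_on ball 0 R" and R: "R > 0"
    and B: "\<And>t. t \<in> ball 0 R \<Longrightarrow> cmod (f t) \<le> B"
  shows "cmod (deriv f 0) \<le> 2 * B / R"
    and "R > 2 \<Longrightarrow> cmod (f 1 - f 0 - deriv f 0) \<le> 32 * B / R\<^sup>2"
proof -
  have Cauchy: "cmod ((deriv ^^ n) f z) \<le> fact n * B / \<rho> ^ n"
    if "cmod z + \<rho> < R" "\<rho> > 0" for n z \<rho>
  proof (rule Cauchy_inequality)
    have sub: "cball z \<rho> \<subseteq> ball 0 R"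
    proof
      fix x assume "x \<in> cball z \<rho>"
      then have "cmod (x - z) \<le> \<rho>" by (simp add: dist_norm norm_minus_commute)
      then show "x \<in> ball 0 R" using norm_triangle_ineq[of z "x - z"] that by simp
    qed
    show "continuous_on (cball z \<rho>) f"
      using sub f holomorphic_on_imp_continuous_on continuous_on_subset by blast
    show "f holomorphic_on ball z \<rho>"
      using sub f ball_subset_cball holomorphic_on_subset by blast
    show "cmod (f x) \<le> B" if "cmod (z - x) = \<rho>" for x
      using sub that by (intro B) (auto simp: dist_norm subset_iff)
  qed (use that in auto)
  show "cmod (deriv f 0) \<le> 2 * B / R"
    using Cauchy[of 0 "R / 2" 1] R by (simp add: mult.commute)
  assume R2: "R > 2"
  define F where "F i = (deriv ^^ i) f" for i :: nat
  have F: "(F i has_field_derivative F (Suc i) x) (at x within ball 0 (R/2))" if "x \<in> ball 0 (R/2)" for i x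
  proof -
    have "F i holomorphic_on ball 0 R" unfolding F_def by (rule holomorphic_higher_deriv[OF f open_ball])
    then have "(F i has_field_derivative deriv (F i) x) (at x)"
      using that R by (intro holomorphic_derivI[of _ "ball 0 R"]) auto
    then show ?thesis by (simp add: F_def has_field_derivative_at_within)
  qed
  \<comment> \<open>First-order Taylor expansion on \<open>ball 0 (R/2)\<close>, which contains 1
    because R > 2; the second derivative is at most 2 B / (R/4)^2 there.\<close>
  have "cmod (F 0 1 - (\<Sum>i\<le>1. F i 0 * (1 - 0) ^ i / fact i)) \<le> (32 * B / R\<^sup>2) * cmod (1 - 0) ^ Suc 1 / fact 1"
  proof (rule field_Taylor[where S = "ball 0 (R/2)" and f = F])
    show "cmod (F (Suc 1) x) \<le> 32 * B / R\<^sup>2" if "x \<in> ball 0 (R/2)" for x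
      using Cauchy[of x "R/4" 2] that R
      by (simp add: F_def numeral_2_eq_2 power_divide mult.commute)
  qed (use R2 F in auto)
  then show "cmod (f 1 - f 0 - deriv f 0) \<le> 32 * B / R\<^sup>2"
    by (simp add: F_def algebra_simps)
qed


text \<open>Pairing with \<open>y\<close> and restricting to the complex line through
  \<open>a\<close> in direction \<open>h\<close> reduces the claim to one variable: the function is
  bounded by \<open>B * norm y\<close>, and t = 1 is the full increment \<open>h\<close>. The
  constants involve only \<open>B\<close> and \<open>r\<close>, so they can later be made uniform
  over unit vectors.\<close>

lemma holo_on_remainder:
  fixes f :: "complex ^ 'n \<Rightarrow> 'e::chilbert_space"
  assumes f: "holo_on f (ball a r)" and r: "r > 0"
    and B: "\<And>z. z \<in> ball a r \<Longrightarrow> norm (f z) \<le> B"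
    and D: "(f has_derivative D) (at a)" "\<And>c v. D (c *s v) = c *\<^sub>C D v"
  shows "norm (D h) \<le> 2 * B / r * norm h"
    and "norm h < r / 2 \<Longrightarrow> norm (f (a + h) - f a - D h) \<le> 32 * B / r\<^sup>2 * (norm h)\<^sup>2"
proof -
  have B0: "B \<ge> 0" using order_trans[OF norm_ge_zero B[of a]] r by simp
  have D0: "D 0 = 0" using bounded_linear.linear[OF has_derivative_bounded_linear[OF D(1)]] linear_0 by blast
  have *: "cmod (cinner (D h) y) \<le> 2 * (B * norm y) / (r / norm h)"
    "norm h < r / 2 \<Longrightarrow> cmod (cinner (f (a + h) - f a - D h) y) \<le> 32 * (B * norm y) / (r / norm h)\<^sup>2"
    if h: "h \<noteq> 0" for y
  proof -
    \<comment> \<open>The line stays in \<open>ball a r\<close> exactly for |t| < R, and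
      \<open>norm h < r / 2\<close> says R > 2.\<close>
    define R where "R = r / norm h"
    define \<psi> where "\<psi> t = cinner (f (a + t *s h)) y" for t
    have R: "R > 0" using r h by (simp add: R_def)
    have in_ball: "a + t *s h \<in> ball a r" if "t \<in> ball 0 R" for t
      using that h by (simp add: R_def dist_norm norm_vector_smult pos_less_divide_eq)
    have deriv_\<psi>: "(\<psi> has_field_derivative cinner (L h) y) (at t)"
      if L: "(f has_derivative L) (at (a + t *s h))" "\<And>c v. L (c *s v) = c *\<^sub>C L v" for t L
    proof -
      have "((\<lambda>t. a + t *s h) has_derivative (\<lambda>u. u *s h)) (at t)"
        by (rule has_derivative_eq_rhs[OF has_derivative_add[OF has_derivative_const
              bounded_linear_imp_has_derivative[OF bounded_linear_vector_smult]]]) simp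
      from has_derivative_compose[OF this L(1)]
      have "((\<lambda>t. f (a + t *s h)) has_derivative (\<lambda>u. L (u *s h))) (at t)" .
      from bounded_linear.has_derivative[OF bounded_linear_cinner_left this, of y]
      show ?thesis
        unfolding has_field_derivative_def \<psi>_def
        by (rule has_derivative_eq_rhs) (simp add: fun_eq_iff L(2) cinner_scaleC_left mult.commute)
    qed
    have "\<psi> holomorphic_on ball 0 R"
    proof (rule holomorphic_onI)
      fix t :: complex assume t: "t \<in> ball 0 R"
      obtain L where "(f has_derivative L) (at (a + t *s h))" "\<forall>c v. L (c *s v) = c *\<^sub>C L v"
        using f in_ball[OF t] unfolding holo_on_def by blast
      then show "\<psi> field_differentiable at t within ball 0 R"
        using deriv_\<psi> field_differentiable_at_within field_differentiable_def by blast
    qed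
    moreover have "cmod (\<psi> t) \<le> B * norm y" if "t \<in> ball 0 R" for t
      unfolding \<psi>_def
      by (rule order_trans[OF cinner_Cauchy_Schwarz])
        (rule mult_right_mono[OF B[OF in_ball[OF that]] norm_ge_zero])
    moreover have "deriv \<psi> 0 = cinner (D h) y"
      by (rule DERIV_imp_deriv, rule deriv_\<psi>) (use D in simp_all)
    ultimately have "cmod (cinner (D h) y) \<le> 2 * (B * norm y) / R"
      and T: "R > 2 \<Longrightarrow> cmod (\<psi> 1 - \<psi> 0 - cinner (D h) y) \<le> 32 * (B * norm y) / R\<^sup>2"
      using Taylor_remainder_unit[of \<psi> R "B * norm y"] R by simp_all
    then show "cmod (cinner (D h) y) \<le> 2 * (B * norm y) / (r / norm h)" by (simp add: R_def)
    have "\<psi> 1 - \<psi> 0 - cinner (D h) y = cinner (f (a + h) - f a - D h) y"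
      by (simp add: \<psi>_def linear_diff[OF bounded_linear.linear[OF bounded_linear_cinner_left]])
    with T show "cmod (cinner (f (a + h) - f a - D h) y) \<le> 32 * (B * norm y) / (r / norm h)\<^sup>2"
      if "norm h < r / 2"
      using that h by (simp add: R_def pos_less_divide_eq)
  qed
  show "norm (D h) \<le> 2 * B / r * norm h"
  proof (cases "h = 0")
    case False
    show ?thesis
      by (rule norm_le_if_cinner_le) (use *(1)[OF False, of "D h"] B0 r in \<open>simp_all add: mult_ac\<close>)
  qed (simp add: D0)
  show "norm (f (a + h) - f a - D h) \<le> 32 * B / r\<^sup>2 * (norm h)\<^sup>2" if "norm h < r / 2"
  proof (cases "h = 0")
    case False
    show ?thesis
      by (rule norm_le_if_cinner_le)
        (use *(2)[OF False that, of "f (a + h) - f a - D h"] B0 r in \<open>simp_all add: mult_ac power_divide\<close>)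
  qed (simp add: D0)
qed

text \<open>Uniqueness of derivatives makes the strong derivatives \<open>D x\<close> linear in
  \<open>x\<close>, and their bound makes them the values of an operator \<open>L h\<close>. Since
  |F(z) x| <= M |x|, the remainder at \<open>x\<close> is at most a constant times |h|^2 |x|, which
  is an operator-norm estimate of second order.\<close>

lemma holo_on_blinfunI:
  fixes F :: "complex ^ 'n \<Rightarrow> 'f::complex_normed_vector \<Rightarrow>\<^sub>L 'e::chilbert_space"
  assumes F: "\<And>x. holo_on (\<lambda>z. blinfun_apply (F z) x) \<Omega>"
    and bound: "\<And>a. a \<in> \<Omega> \<Longrightarrow> \<exists>r>0. \<exists>M. ball a r \<subseteq> \<Omega> \<and> (\<forall>z\<in>ball a r. norm (F z) \<le> M)"
  shows "holo_on F \<Omega>"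
  unfolding holo_on_def
proof
  fix a assume a: "a \<in> \<Omega>"
  obtain r M where r: "r > 0" "ball a r \<subseteq> \<Omega>" and M: "\<And>z. z \<in> ball a r \<Longrightarrow> norm (F z) \<le> M"
    using bound[OF a] by blast
  have "\<exists>L. ((\<lambda>z. blinfun_apply (F z) x) has_derivative L) (at a) \<and> (\<forall>c v. L (c *s v) = c *\<^sub>C L v)" for x
    using F[of x] a unfolding holo_on_def by blast
  then obtain D where D: "\<And>x. ((\<lambda>z. blinfun_apply (F z) x) has_derivative D x) (at a)"
      "\<And>x c v. D x (c *s v) = c *\<^sub>C D x v"
    by metis
  have D_add: "D (x + y) = (\<lambda>h. D x h + D y h)" for x y
    by (rule has_derivative_unique[OF D(1)])
      (use has_derivative_add[OF D(1) D(1)] in \<open>simp add: blinfun.add_right\<close>)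
  have D_scaleR: "D (c *\<^sub>R x) = (\<lambda>h. c *\<^sub>R D x h)" for c x
    by (rule has_derivative_unique[OF D(1)])
      (use has_derivative_scaleR_right[OF D(1)] in \<open>simp add: blinfun.scaleR_right\<close>)
  have holo: "holo_on (\<lambda>z. blinfun_apply (F z) x) (ball a r)" for x
    using F r(2) unfolding holo_on_def by blast
  have FB: "norm (blinfun_apply (F z) x) \<le> M * norm x" if "z \<in> ball a r" for z x
    using norm_blinfun[of "F z" x] mult_right_mono[OF M[OF that] norm_ge_zero[of x]] by linarith
  have D_bound: "norm (D x h) \<le> (2 * M / r * norm h) * norm x" for x h
    using holo_on_remainder(1)[OF holo r(1) FB D, of x h] by (simp add: mult_ac)
  have rem: "norm (blinfun_apply (F (a + h)) x - blinfun_apply (F a) x - D x h)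
      \<le> (32 * M / r\<^sup>2 * (norm h)\<^sup>2) * norm x" if "norm h < r / 2" for x h
    using holo_on_remainder(2)[OF holo r(1) FB D that, of x] by (simp add: mult_ac)
  have M0: "M \<ge> 0" using order_trans[OF norm_ge_zero M[of a]] r(1) by simp
  define L where "L h = Blinfun (\<lambda>x. D x h)" for h
  have L: "blinfun_apply (L h) x = D x h" for h x
  proof -
    have "bounded_linear (\<lambda>x. D x h)"
    proof (rule bounded_linear_intro[where K = "2 * M / r * norm h"])
      show "norm (D x h) \<le> norm x * (2 * M / r * norm h)" for x
        using D_bound[of x h] by (simp only: mult.commute)
    qed (simp_all add: D_add D_scaleR)
    then show ?thesis unfolding L_def by (simp add: bounded_linear_Blinfun_apply)
  qed
  note lin = bounded_linear.linear[OF has_derivative_bounded_linear[OF D(1)]]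
  have L_bl: "bounded_linear L"
  proof (rule bounded_linear_intro[where K = "2 * M / r"])
    show "L (h + k) = L h + L k" for h k
      by (rule blinfun_eqI) (simp add: L blinfun.add_left linear_add[OF lin])
    show "L (c *\<^sub>R h) = c *\<^sub>R L h" for c h
      by (rule blinfun_eqI) (simp add: L blinfun.scaleR_left linear_scale[OF lin])
    show "norm (L h) \<le> norm h * (2 * M / r)" for h
      by (rule norm_blinfun_bound) (use D_bound[of _ h] M0 r(1) in \<open>simp_all add: L mult_ac\<close>)
  qed
  have "(F has_derivative L) (at a)"
  proof (rule has_derivativeI_sandwich[where e = "r / 2" and H = "\<lambda>y. 32 * M / r\<^sup>2 * norm (y - a)"])
    fix y assume y: "y \<noteq> a" "dist y a < r / 2"
    have "norm (F y - F a - L (y - a)) \<le> 32 * M / r\<^sup>2 * (norm (y - a))\<^sup>2"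
      by (rule norm_blinfun_bound)
        (use rem[of "y - a"] y M0 in \<open>simp_all add: L blinfun.diff_left dist_norm\<close>)
    then show "norm (F y - F a - L (y - a)) / norm (y - a) \<le> 32 * M / r\<^sup>2 * norm (y - a)"
      using y(1) by (simp add: pos_divide_le_eq power2_eq_square mult.assoc)
  next
    have "((\<lambda>y. 32 * M / r\<^sup>2 * norm (y - a)) \<longlongrightarrow> 32 * M / r\<^sup>2 * norm (a - a)) (at a)"
      by (intro tendsto_intros)
    then show "((\<lambda>y. 32 * M / r\<^sup>2 * norm (y - a)) \<longlongrightarrow> 0) (at a)" by simp
  qed (use r(1) L_bl in simp_all)
  moreover have "L (c *s v) = c *\<^sub>C L v" for c v
    by (rule blinfun_eqI) (simp add: L D(2) scaleC_blinfun_apply)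
  ultimately show "\<exists>L. (F has_derivative L) (at a) \<and> (\<forall>c v. L (c *s v) = c *\<^sub>C L v)" by blast
qed

section \<open>Adjoints on Hilbert space types and Banach-Steinhaus for operator families\<close>

lemma hbounded_blinfun:
  assumes "A \<in> complex_ops"
  shows "hbounded type_hspace type_hspace (blinfun_apply A)"
  using assms norm_blinfun[of A]
  by (auto simp: hbounded_def hlinear_def complex_ops_def blinfun.add_right)

text \<open>\<open>Blinfun\<close> can only be unfolded for bounded linear arguments, so the
  boundedness of the adjoint has to be established before \<open>op_adj\<close> means
  anything.\<close>

lemma op_adj_apply:
  assumes "A \<in> complex_ops"
  shows "blinfun_apply (op_adj A) = hadj type_hspace type_hspace (blinfun_apply A)"
proof -
  have "hbounded type_hspace type_hspace (hadj type_hspace type_hspace (blinfun_apply A))"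
    by (rule hbounded_hadj[OF hilbert_type_hspace pre_hilbert_type_hspace hbounded_blinfun[OF assms]])
  then obtain C where "hlinear type_hspace type_hspace (hadj type_hspace type_hspace (blinfun_apply A))"
      "\<And>x. norm (hadj type_hspace type_hspace (blinfun_apply A) x) \<le> C * norm x"
    by (auto simp: hbounded_def)
  then have "bounded_linear (hadj type_hspace type_hspace (blinfun_apply A))"
    by (intro bounded_linear_intro[where K = C]) (auto simp: hlinear_def scaleR_scaleC mult.commute)
  then show ?thesis unfolding op_adj_def by (rule bounded_linear_Blinfun_apply)
qed

lemma cinner_op_adj:
  assumes "A \<in> complex_ops"
  shows "cinner (blinfun_apply A x) y = cinner x (blinfun_apply (op_adj A) y)"
  using hinner_hadj[OF hilbert_type_hspace pre_hilbert_type_hspace hbounded_blinfun[OF assms], of y x]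
  by (simp add: op_adj_apply[OF assms])

lemma op_adj_eqI:
  assumes "A \<in> complex_ops" "\<And>x. cinner (blinfun_apply A x) y = cinner x y'"
  shows "blinfun_apply (op_adj A) y = y'"
  unfolding op_adj_apply[OF assms(1)]
  by (rule hadj_eqI[OF pre_hilbert_type_hspace]) (use assms(2) in simp_all)

text \<open>Uniform boundedness for vectors is applied to the adjoints of the \<open>F z\<close>
  evaluated on the unit ball: pairing such a vector with \<open>x\<close> gives <F(z) x, y>, which
  is bounded by hypothesis. The norm of \<open>F z\<close> is recovered from its adjoint by testing
  v = F(z) x against itself.\<close>

lemma bounded_family_if_pointwise_bounded:
  fixes F :: "'z \<Rightarrow> 'f::chilbert_space \<Rightarrow>\<^sub>L 'e::chilbert_space"
  assumes F: "\<And>z. z \<in> S \<Longrightarrow> F z \<in> complex_ops"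
    and ptw: "\<And>x. bounded ((\<lambda>z. blinfun_apply (F z) x) ` S)"
  shows "\<exists>M. \<forall>z\<in>S. norm (F z) \<le> M"
proof -
  define Y where "Y = {blinfun_apply (op_adj (F z)) y | z y. z \<in> S \<and> norm y \<le> 1}"
  have "\<exists>C. \<forall>y\<in>Y. cmod (cinner x y) \<le> C" for x
  proof -
    obtain C where C: "\<And>z. z \<in> S \<Longrightarrow> norm (blinfun_apply (F z) x) \<le> C"
      using ptw[of x] unfolding bounded_iff by blast
    have "cmod (cinner x (blinfun_apply (op_adj (F z)) y)) \<le> C" if z: "z \<in> S" and y: "norm y \<le> 1" for z y
    proof -
      have "cmod (cinner x (blinfun_apply (op_adj (F z)) y)) \<le> norm (blinfun_apply (F z) x) * norm y"
        by (simp add: cinner_op_adj[OF F[OF z], symmetric] cinner_Cauchy_Schwarz)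
      also have "\<dots> \<le> norm (blinfun_apply (F z) x)" using y by (simp add: mult_left_le)
      finally show ?thesis using C[OF z] by linarith
    qed
    then show ?thesis unfolding Y_def by blast
  qed
  then have "\<exists>C. \<forall>y\<in>Y. norm y \<le> C"
    using hilbert.uniform_boundedness[OF hilbert_type_hspace, of Y] by simp
  then obtain C where C: "\<And>z y. \<lbrakk>z \<in> S; norm y \<le> 1\<rbrakk> \<Longrightarrow> norm (blinfun_apply (op_adj (F z)) y) \<le> C"
    unfolding Y_def by blast
  have "norm (F z) \<le> C" if z: "z \<in> S" for z
  proof (rule norm_blinfun_bound)
    show C0: "C \<ge> 0" using order_trans[OF norm_ge_zero C[OF z, of 0]] by simp
    fix x
    define v where "v = blinfun_apply (F z) x"
    have "norm v \<le> C * norm x"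
    proof (cases "v = 0")
      case False
      have "norm (blinfun_apply (op_adj (F z)) (inverse (norm v) *\<^sub>R v)) \<le> C"
        using False by (intro C z) simp
      then have "norm (blinfun_apply (op_adj (F z)) v) \<le> C * norm v"
        using False by (simp add: blinfun.scaleR_right field_simps)
      then have "norm x * norm (blinfun_apply (op_adj (F z)) v) \<le> norm x * (C * norm v)"
        by (rule mult_left_mono) simp
      moreover have "cinner v v = cinner x (blinfun_apply (op_adj (F z)) v)"
        using cinner_op_adj[OF F[OF z], of x v] by (simp add: v_def)
      ultimately have "cmod (cinner v v) \<le> norm x * (C * norm v)"
        using cinner_Cauchy_Schwarz[of x "blinfun_apply (op_adj (F z)) v"] by simp
      then have "cmod (cinner v v) \<le> C * norm x * norm v" by (simp only: mult_ac)
      then show ?thesis by (rule norm_le_if_cinner_le) (simp add: C0)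
    qed (use C0 in simp)
    then show "norm (blinfun_apply (F z) x) \<le> C * norm x" by (simp add: v_def)
  qed
  then show ?thesis by blast
qed

text \<open>Strong holomorphy gives strong continuity; on a compact \<open>cball\<close> inside
  \<Omega> every orbit is therefore bounded, and Banach-Steinhaus provides the local norm bound that
  \<open>holo_on_blinfunI\<close> requires.\<close>

lemma holo_on_if_strongly_holo_on:
  fixes F :: "complex ^ 'n \<Rightarrow> 'f::chilbert_space \<Rightarrow>\<^sub>L 'e::chilbert_space"
  assumes "open \<Omega>" and F: "\<And>z. z \<in> \<Omega> \<Longrightarrow> F z \<in> complex_ops"
    and holo: "\<And>x. holo_on (\<lambda>z. blinfun_apply (F z) x) \<Omega>"
  shows "holo_on F \<Omega>"
proof (rule holo_on_blinfunI[OF holo])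
  fix a assume "a \<in> \<Omega>"
  then obtain r where r: "r > 0" "cball a r \<subseteq> \<Omega>"
    using \<open>open \<Omega>\<close> open_contains_cball by blast
  have "continuous_on (cball a r) (\<lambda>z. blinfun_apply (F z) x)" for x
    using holo[of x] r(2) unfolding holo_on_def continuous_on_eq_continuous_within
    by (meson continuous_at_imp_continuous_within has_derivative_continuous subsetD)
  then have "bounded ((\<lambda>z. blinfun_apply (F z) x) ` cball a r)" for x
    using compact_continuous_image[OF _ compact_cball] compact_imp_bounded by blast
  then obtain M where "\<forall>z\<in>cball a r. norm (F z) \<le> M"
    using bounded_family_if_pointwise_bounded[of "cball a r" F] F r(2) by blast
  then show "\<exists>r>0. \<exists>M. ball a r \<subseteq> \<Omega> \<and> (\<forall>z\<in>ball a r. norm (F z) \<le> M)"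
    using r ball_subset_cball[of a r] by blast
qed

section \<open>Reproducing kernel Hilbert modules\<close>

text \<open>Linear combinations of the \<open>a i\<close> and the \<open>b i\<close> with the same
  coefficients, kept as a relation since sending \<open>a i\<close> to \<open>b i\<close> is not yet
  known to be well defined. Building them one term at a time replaces finite sums by
  induction.\<close>

inductive_set paired_span :: "'i set \<Rightarrow> ('i \<Rightarrow> 'a::complex_vector) \<Rightarrow> ('i \<Rightarrow> 'b::complex_vector) \<Rightarrow> ('a \<times> 'b) set"
  for I a b
  where zero: "(0, 0) \<in> paired_span I a b"
  | insert: "\<lbrakk>(s, r) \<in> paired_span I a b; i \<in> I\<rbrakk> \<Longrightarrow> (s + c *\<^sub>C a i, r + c *\<^sub>C b i) \<in> paired_span I a b"

lemma paired_span_add: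
  assumes "(s, r) \<in> paired_span I a b" "(s', r') \<in> paired_span I a b"
  shows "(s + s', r + r') \<in> paired_span I a b"
  using assms(2)
proof induction
  case (insert s' r' i c)
  then show ?case
    using paired_span.insert[OF insert.IH insert.hyps(2), of c] by (simp add: add.assoc)
qed (simp add: assms(1))

lemma paired_span_scale:
  assumes "(s, r) \<in> paired_span I a b"
  shows "(k *\<^sub>C s, k *\<^sub>C r) \<in> paired_span I a b"
  using assms
proof induction
  case (insert s r i c)
  then show ?case
    using paired_span.insert[OF insert.IH insert.hyps(2), of "k * c"]
    by (simp add: scaleC_add_right scaleC_scaleC)
qed (simp add: paired_span.zero)

text \<open>Polarisation: expanding the norm of x + a y for a = 1 and a = i yields the real and the
  imaginary part.\<close>

lemma hisometry_inner:
  assumes V: "hisometry H1 H2 V" and "pre_hilbert H1" "pre_hilbert H2"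
    and x: "x \<in> hcarrier H1" and y: "y \<in> hcarrier H1"
  shows "hinner H2 (V x) (V y) = hinner H1 x y"
proof -
  interpret H1: pre_hilbert H1 by fact
  interpret H2: pre_hilbert H2 by fact
  have lin: "hlinear H1 H2 V" and norm: "\<And>u. u \<in> hcarrier H1 \<Longrightarrow> hnorm H2 (V u) = hnorm H1 u"
    using V by (simp_all add: hisometry_def)
  have "Re (cnj a * hinner H2 (V x) (V y)) = Re (cnj a * hinner H1 x y)" for a
  proof -
    have ay: "a *\<^sub>C y \<in> hcarrier H1" using y by (rule H1.carrier_scaleC)
    have "V (x + a *\<^sub>C y) = V x + a *\<^sub>C V y"
      using hlinearD(2)[OF lin x ay] hlinearD(3)[OF lin y] by simp
    with norm[OF H1.carrier_add[OF x ay]]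
    have "hnorm H2 (V x + a *\<^sub>C V y) = hnorm H1 (x + a *\<^sub>C y)" by simp
    then show ?thesis
      using H1.hnorm_add_sq[OF x y, of a] norm[OF x] norm[OF y]
        H2.hnorm_add_sq[OF hlinearD(1)[OF lin x] hlinearD(1)[OF lin y], of a] by simp
  qed
  from this[of 1] this[of "\<i>"] show ?thesis by (simp add: complex_eq_iff)
qed

text \<open>Equal Gram matrices make the relation \<open>paired_span\<close> preserve inner
  products, hence norms; this gives the bound with constant 1 needed for an extension, and
  approximating \<open>x\<close> and \<open>V x\<close> together carries the equality of norms to
  the closure.\<close>

lemma isometric_extension:
  assumes "pre_hilbert H1" "hilbert H2"
    and a: "\<And>i. i \<in> I \<Longrightarrow> a i \<in> hcarrier H1" and b: "\<And>i. i \<in> I \<Longrightarrow> b i \<in> hcarrier H2"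
    and eq: "\<And>i j. \<lbrakk>i \<in> I; j \<in> I\<rbrakk> \<Longrightarrow> hinner H1 (a i) (a j) = hinner H2 (b i) (b j)"
    and dense: "hdense_span H1 (a ` I)"
  obtains V where "hisometry H1 H2 V" "\<And>i. i \<in> I \<Longrightarrow> V (a i) = b i"
proof -
  interpret H1: pre_hilbert H1 by fact
  interpret H2: hilbert H2 by fact
  let ?G = "paired_span I a b"
  have carrier: "s \<in> hcarrier H1 \<and> r \<in> hcarrier H2" if "(s, r) \<in> ?G" for s r
    using that
    by induction (simp_all add: a b H1.carrier_zero H2.carrier_zero H1.carrier_add H2.carrier_add
      H1.carrier_scaleC H2.carrier_scaleC)
  \<comment> \<open>The induction runs over one argument at a time: arbitrary pairs against
    generators here, then arbitrary pairs against each other.\<close>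
  have inner_a: "hinner H1 s (a j) = hinner H2 r (b j)" if "(s, r) \<in> ?G" "j \<in> I" for s r j
    using that
  proof induction
    case (insert s r i c)
    then show ?case
      using carrier[OF insert.hyps(1)]
      by (simp add: a b eq H1.inner_add_left H2.inner_add_left H1.carrier_scaleC H2.carrier_scaleC
          H1.inner_scaleC_left H2.inner_scaleC_left)
  qed (simp add: a b H1.inner_zero_left H2.inner_zero_left)
  have inner: "hinner H1 s s' = hinner H2 r r'" if G: "(s, r) \<in> ?G" "(s', r') \<in> ?G" for s r s' r'
    using G(2)
  proof induction
    case (insert s' r' i c)
    then show ?case
      using carrier[OF insert.hyps(1)] carrier[OF G(1)] inner_a[OF G(1)]
      by (simp add: a b H1.inner_add_right H2.inner_add_right H1.carrier_scaleC H2.carrier_scaleC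
          H1.inner_scaleC_right H2.inner_scaleC_right)
  qed (use carrier[OF G(1)] in \<open>simp add: H1.inner_zero_right H2.inner_zero_right\<close>)
  have norm: "hnorm H2 r = hnorm H1 s" if "(s, r) \<in> ?G" for s r
    using inner[OF that that] by (simp add: hnorm_def)
  have elem: "(a i, b i) \<in> ?G" if "i \<in> I" for i
    using paired_span.insert[OF paired_span.zero that, of 1 a b] by (simp add: scaleC_one)
  have "csubspace (fst ` ?G)"
  proof (rule CV.subspaceI)
    show "0 \<in> fst ` ?G" using image_eqI[OF _ paired_span.zero, of 0 fst] by simp
    show "x + y \<in> fst ` ?G" if xy: "x \<in> fst ` ?G" "y \<in> fst ` ?G" for x y
    proof -
      obtain r r' where "(x, r) \<in> ?G" "(y, r') \<in> ?G" using xy by auto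
      from image_eqI[OF _ paired_span_add[OF this], of "x + y" fst] show ?thesis by simp
    qed
    show "c *\<^sub>C x \<in> fst ` ?G" if x: "x \<in> fst ` ?G" for c x
    proof -
      obtain r where "(x, r) \<in> ?G" using x by auto
      from image_eqI[OF _ paired_span_scale[OF this, of c], of "c *\<^sub>C x" fst] show ?thesis by simp
    qed
  qed
  moreover have "a ` I \<subseteq> fst ` ?G" using elem by (force simp: image_iff)
  ultimately have span: "cspan (a ` I) \<subseteq> fst ` ?G" by (intro CV.span_minimal)
  obtain V where V: "hlinear H1 H2 V" "\<And>s r. (s, r) \<in> ?G \<Longrightarrow> V s = r"
    "\<And>x e. \<lbrakk>x \<in> hcarrier H1; e > 0\<rbrakk> \<Longrightarrow> \<exists>(s, r)\<in>?G. hnorm H1 (x - s) < e \<and> hnorm H2 (V x - r) < e"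
  proof (rule bounded_extension[OF H1.pre_hilbert_axioms H2.hilbert_axioms, of ?G 1])
    fix x and e :: real assume "x \<in> hcarrier H1" "e > 0"
    then obtain s where "s \<in> cspan (a ` I)" "hnorm H1 (x - s) < e"
      using dense unfolding hdense_span_def by blast
    then show "\<exists>(s, r)\<in>?G. hnorm H1 (x - s) < e" using span by force
  qed (use carrier paired_span_add paired_span_scale norm in auto)
  have "hnorm H2 (V x) = hnorm H1 x" if x: "x \<in> hcarrier H1" for x
  proof -
    have "\<bar>hnorm H2 (V x) - hnorm H1 x\<bar> \<le> 0"
    proof (rule field_le_epsilon)
      fix e :: real assume "e > 0"
      then obtain s r where sr: "(s, r) \<in> ?G" "hnorm H1 (x - s) < e / 2" "hnorm H2 (V x - r) < e / 2"
        using V(3)[OF x, of "e / 2"] by auto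
      then show "\<bar>hnorm H2 (V x) - hnorm H1 x\<bar> \<le> 0 + e"
        using H1.hnorm_diff_approx[OF x, of s] H2.hnorm_diff_approx[OF hlinearD(1)[OF V(1) x], of r]
          carrier[OF sr(1)] norm[OF sr(1)] by linarith
    qed
    then show ?thesis by simp
  qed
  with V(1) have "hisometry H1 H2 V" by (simp add: hisometry_def)
  then show ?thesis using that V(2)[OF elem] by blast
qed

section \<open>Point evaluations and coordinate multiplications\<close>

lemma
  assumes "rkhs \<Omega> K H"
  shows rkhs_hilbert: "hilbert H"
    and rkhs_dense: "hdense_span H {kernel_fun \<Omega> K w \<eta> | w \<eta>. w \<in> \<Omega>}"
    and rkhs_kernel_fun: "w \<in> \<Omega> \<Longrightarrow> kernel_fun \<Omega> K w \<eta> \<in> hcarrier H"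
    and rkhs_reproducing: "\<lbrakk>f \<in> hcarrier H; w \<in> \<Omega>\<rbrakk> \<Longrightarrow> hinner H f (kernel_fun \<Omega> K w \<eta>) = cinner (f w) \<eta>"
    and rkhs_outside: "\<lbrakk>f \<in> hcarrier H; w \<notin> \<Omega>\<rbrakk> \<Longrightarrow> f w = 0"
proof -
  from assms show "hilbert H" and D: "hdense_span H {kernel_fun \<Omega> K w \<eta> | w \<eta>. w \<in> \<Omega>}"
    and "\<lbrakk>f \<in> hcarrier H; w \<in> \<Omega>\<rbrakk> \<Longrightarrow> hinner H f (kernel_fun \<Omega> K w \<eta>) = cinner (f w) \<eta>"
    and "\<lbrakk>f \<in> hcarrier H; w \<notin> \<Omega>\<rbrakk> \<Longrightarrow> f w = 0"
    by (simp_all add: rkhs_def)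
  from D show "w \<in> \<Omega> \<Longrightarrow> kernel_fun \<Omega> K w \<eta> \<in> hcarrier H"
    unfolding hdense_span_def by blast
qed

lemma rkhs_inner_kernel_fun:
  assumes "rkhs \<Omega> K H" "w \<in> \<Omega>" "z \<in> \<Omega>"
  shows "hinner H (kernel_fun \<Omega> K w \<eta>) (kernel_fun \<Omega> K z \<zeta>) = cinner (blinfun_apply (K z w) \<eta>) \<zeta>"
  using rkhs_reproducing[OF assms(1) rkhs_kernel_fun[OF assms(1,2)] assms(3)] assms(3)
  by (simp add: kernel_fun_def)

text \<open>Use \<open>f z\<close> itself as the direction of the kernel function \<open>k\<close>:
  then |f(z)|^2 = <f, k>, and |k|^2 = <K(z,z) f(z), f(z)> is at most the norm of K(z,z) times
  |f(z)|^2.\<close>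

lemma rkhs_eval_bound:
  assumes H: "rkhs \<Omega> K H" and f: "f \<in> hcarrier H" and z: "z \<in> \<Omega>"
  shows "norm (f z) \<le> hnorm H f * sqrt (norm (K z z))"
proof -
  interpret H: hilbert H by (rule rkhs_hilbert[OF H])
  define k where "k = kernel_fun \<Omega> K z (f z)"
  have k: "k \<in> hcarrier H" unfolding k_def by (rule rkhs_kernel_fun[OF H z])
  have "(hnorm H k)\<^sup>2 = cmod (hinner H k k)" by (simp add: H.inner_self[OF k] norm_power)
  also have "hinner H k k = cinner (blinfun_apply (K z z) (f z)) (f z)"
    unfolding k_def by (rule rkhs_inner_kernel_fun[OF H z z])
  also have "cmod \<dots> \<le> norm (blinfun_apply (K z z) (f z)) * norm (f z)" by (rule cinner_Cauchy_Schwarz)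
  also have "\<dots> \<le> norm (K z z) * norm (f z) * norm (f z)"
    by (intro mult_right_mono norm_blinfun) simp
  also have "\<dots> = (sqrt (norm (K z z)) * norm (f z))\<^sup>2"
    by (simp add: power_mult_distrib power2_eq_square)
  finally have "hnorm H k \<le> sqrt (norm (K z z)) * norm (f z)"
    by (rule power2_le_imp_le) simp
  then have "hnorm H f * hnorm H k \<le> hnorm H f * (sqrt (norm (K z z)) * norm (f z))"
    using H.hnorm_nonneg[OF f] by (rule mult_left_mono)
  moreover have "cinner (f z) (f z) = hinner H f k"
    unfolding k_def by (rule rkhs_reproducing[OF H f z, symmetric])
  ultimately have "cmod (cinner (f z) (f z)) \<le> hnorm H f * sqrt (norm (K z z)) * norm (f z)"
    using H.cauchy_schwarz[OF f k] by (simp add: mult.assoc)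
  then show ?thesis by (rule norm_le_if_cinner_le) (simp add: H.hnorm_nonneg[OF f])
qed

lemma hlinear_coord_mult:
  assumes "rkh_module \<Omega> K H"
  shows "hlinear H H (coord_mult j)"
  using assms
  by (auto simp: rkh_module_def hlinear_def coord_mult_def fun_eq_iff scaleC_fun_def
      scaleC_add_right scaleC_scaleC mult.commute)

text \<open>By the reproducing property both sides equal w_j <f(w), \<eta>>. This exhibits an
  adjoint vector at every kernel function before boundedness of the multiplication is
  available.\<close>

lemma coord_mult_inner_kernel_fun:
  assumes H: "rkh_module \<Omega> K H" and w: "w \<in> \<Omega>" and f: "f \<in> hcarrier H"
  shows "hinner H (coord_mult j f) (kernel_fun \<Omega> K w \<eta>)
    = hinner H f (cnj (w $ j) *\<^sub>C kernel_fun \<Omega> K w \<eta>)"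
proof -
  have K: "rkhs \<Omega> K H" using H by (simp add: rkh_module_def)
  interpret H: hilbert H by (rule rkhs_hilbert[OF K])
  show ?thesis
    using rkhs_reproducing[OF K hlinearD(1)[OF hlinear_coord_mult[OF H] f] w]
      rkhs_reproducing[OF K f w] rkhs_kernel_fun[OF K w] f
    by (simp add: H.inner_scaleC_right coord_mult_def cinner_scaleC_left)
qed

text \<open>Kernel functions are total and have adjoint vectors, so
  \<open>hellinger_toeplitz\<close> applies; the same vectors show that they are joint eigenvectors
  of the adjoints.\<close>

lemma
  assumes H: "rkh_module \<Omega> K H"
  shows hbounded_coord_mult: "hbounded H H (coord_mult j)"
    and hadj_coord_mult_kernel_fun: "w \<in> \<Omega> \<Longrightarrow>
      hadj H H (coord_mult j) (kernel_fun \<Omega> K w \<eta>) = cnj (w $ j) *\<^sub>C kernel_fun \<Omega> K w \<eta>"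
proof -
  have K: "rkhs \<Omega> K H" using H by (simp add: rkh_module_def)
  interpret H: hilbert H by (rule rkhs_hilbert[OF K])
  have k: "c *\<^sub>C kernel_fun \<Omega> K w \<eta> \<in> hcarrier H" if "w \<in> \<Omega>" for c w \<eta>
    using rkhs_kernel_fun[OF K that] by (rule H.carrier_scaleC)
  show "hbounded H H (coord_mult j)"
  proof (rule hellinger_toeplitz[OF H.hilbert_axioms H.pre_hilbert_axioms hlinear_coord_mult[OF H] rkhs_dense[OF K]])
    fix s assume "s \<in> {kernel_fun \<Omega> K w \<eta> | w \<eta>. w \<in> \<Omega>}"
    then obtain w \<eta> where s: "s = kernel_fun \<Omega> K w \<eta>" and w: "w \<in> \<Omega>" by blast
    show "\<exists>y\<in>hcarrier H. \<forall>u\<in>hcarrier H. hinner H (coord_mult j u) s = hinner H u y"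
      using k[OF w] coord_mult_inner_kernel_fun[OF H w] unfolding s by blast
  qed
  show "hadj H H (coord_mult j) (kernel_fun \<Omega> K w \<eta>) = cnj (w $ j) *\<^sub>C kernel_fun \<Omega> K w \<eta>"
    if w: "w \<in> \<Omega>"
    by (rule hadj_eqI[OF H.pre_hilbert_axioms k[OF w] coord_mult_inner_kernel_fun[OF H w]])
qed

lemma cinner_eqI_left:
  assumes "\<And>y. cinner x y = cinner x' (y :: 'a::chilbert_space)"
  shows "x = x'"
proof -
  have "cinner (x - x') (x - x') = cinner x (x - x') - cinner x' (x - x')"
    by (rule linear_diff[OF bounded_linear.linear[OF bounded_linear_cinner_left]])
  also have "\<dots> = 0" by (simp add: assms)
  finally show ?thesis by (simp add: cinner_self_eq_0)
qed

lemma scalar_kernel_apply: "blinfun_apply (scalar_kernel g z w) c = g z w * c"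
  by (simp add: scalar_kernel_def scaleC_blinfun_apply scaleC_complex_def)


theorem theorem6p1:
  fixes \<Omega> :: "(complex ^ 'n) set"
    and g :: "complex ^ 'n \<Rightarrow> complex ^ 'n \<Rightarrow> complex"
    and Hg :: "(complex ^ 'n \<Rightarrow> complex) hspace"
    and K :: "complex ^ 'n \<Rightarrow> complex ^ 'n \<Rightarrow> 'e::chilbert_space \<Rightarrow>\<^sub>L 'e"
    and HK :: "(complex ^ 'n \<Rightarrow> 'e) hspace"
    and T :: "'t::complex_vector hspace"
    and \<tau> :: "(complex ^ 'n \<Rightarrow> complex) \<Rightarrow> 'f::chilbert_space \<Rightarrow> 't"
  assumes "bounded_domain \<Omega>"
    and "good_rkh_module \<Omega> g Hg"
    and "rkh_module \<Omega> K HK"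
    and "\<forall>f\<in>hcarrier HK. holo_on f \<Omega>"
    and "hilbert_tensor Hg (type_hspace :: 'f hspace) T \<tau>"
  shows "dilates HK Hg (type_hspace :: 'f hspace) T \<tau> \<longleftrightarrow>
    (\<exists>\<Phi> :: complex ^ 'n \<Rightarrow> 'f \<Rightarrow>\<^sub>L 'e.
      (\<forall>z\<in>\<Omega>. \<Phi> z \<in> complex_ops) \<and> holo_on \<Phi> \<Omega> \<and>
      (\<forall>z\<in>\<Omega>. \<forall>w\<in>\<Omega>. K z w = g z w *\<^sub>C (\<Phi> z o\<^sub>L op_adj (\<Phi> w))))"
proof -
  interpret tens: hilbert_tensor Hg "type_hspace :: 'f hspace" T \<tau> by (rule assms(5))
  have Mg: "rkh_module \<Omega> (scalar_kernel g) Hg" using assms(2) by (simp add: good_rkh_module_def)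
  have Rg: "rkhs \<Omega> (scalar_kernel g) Hg" using Mg by (simp add: rkh_module_def)
  have RK: "rkhs \<Omega> K HK" using assms(3) by (simp add: rkh_module_def)
  interpret HK: hilbert HK by (rule rkhs_hilbert[OF RK])
  note bg = hbounded_coord_mult[OF Mg] and bK = hbounded_coord_mult[OF assms(3)]
  note badjg = hbounded_hadj[OF tens.H1.hilbert_axioms tens.H1.pre_hilbert_axioms bg]
  note badjK = hbounded_hadj[OF HK.hilbert_axioms HK.pre_hilbert_axioms bK]
  define G where "G w = kernel_fun \<Omega> (scalar_kernel g) w 1" for w
  define M where "M i = tensor_op Hg type_hspace T \<tau> (hadj Hg Hg (coord_mult i)) (\<lambda>x. x)" for i
  have G: "G w \<in> hcarrier Hg" if "w \<in> \<Omega>" for w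
    unfolding G_def by (rule rkhs_kernel_fun[OF Rg that])
  have G_inner: "hinner Hg (G w) (G z) = g z w" if "w \<in> \<Omega>" "z \<in> \<Omega>" for w z
    unfolding G_def rkhs_inner_kernel_fun[OF Rg that]
    by (simp add: scalar_kernel_apply cinner_complex_def)
  have G_adj: "hadj Hg Hg (coord_mult i) (G w) = cnj (w $ i) *\<^sub>C G w" if "w \<in> \<Omega>" for i w
    unfolding G_def by (rule hadj_coord_mult_kernel_fun[OF Mg that])
  have bM: "hbounded T T (M i)" for i
    unfolding M_def by (rule tens.hbounded_tensor_op[OF badjg])
  have M_tensor: "M i (\<tau> x y) = \<tau> (hadj Hg Hg (coord_mult i) x) y" if "x \<in> hcarrier Hg" for i x y
    unfolding M_def by (rule tens.tensor_op_tensor[OF badjg that]) simp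
  have K_adj: "hadj HK HK (coord_mult i) (kernel_fun \<Omega> K w \<eta>) = cnj (w $ i) *\<^sub>C kernel_fun \<Omega> K w \<eta>"
    if "w \<in> \<Omega>" for i w \<eta>
    by (rule hadj_coord_mult_kernel_fun[OF assms(3) that])
  have K_carrier: "kernel_fun \<Omega> K w \<eta> \<in> hcarrier HK" if "w \<in> \<Omega>" for w \<eta>
    by (rule rkhs_kernel_fun[OF RK that])
  obtain w0 where w0: "w0 \<in> \<Omega>" "\<And>z. z \<in> \<Omega> \<Longrightarrow> g z w0 = 1"
    using assms(2) by (auto simp: good_rkh_module_def)
  have "open \<Omega>" using assms(1) by (simp add: bounded_domain_def)
  show ?thesis
  proof
    assume "dilates HK Hg (type_hspace :: 'f hspace) T \<tau>"
    then obtain V where V: "hisometry HK T V"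
      and MV: "\<And>i f. f \<in> hcarrier HK \<Longrightarrow> M i (V f) = V (hadj HK HK (coord_mult i) f)"
      unfolding dilates_def M_def by blast
    have linV: "hlinear HK T V" using V by (simp add: hisometry_def)
    have bV: "hbounded HK T V" by (rule hisometry_hbounded[OF V])
    \<comment> \<open>The normalisation at \<open>w0\<close> is what excludes zero: <G w0, G w> =
      g(w, w0) = 1.\<close>
    have G_nonzero: "G w \<noteq> 0" if "w \<in> \<Omega>" for w
      using G_inner[OF w0(1) that] w0(2)[OF that] tens.H1.inner_zero_right[OF G[OF w0(1)]] by auto
    have kernel: "\<exists>a. f = a *\<^sub>C G w"
      if w: "w \<in> \<Omega>" and f: "f \<in> hcarrier Hg" "\<And>i. hadj Hg Hg (coord_mult i) f = cnj (w $ i) *\<^sub>C f" for f w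
    proof -
      have "G w = (\<lambda>z. if z \<in> \<Omega> then g z w else 0)"
        by (simp add: G_def kernel_fun_def scalar_kernel_apply fun_eq_iff)
      moreover have "f \<in> (\<Inter>j. {f \<in> hcarrier Hg. hadj Hg Hg (coord_mult j) f - cnj (w $ j) *\<^sub>C f = 0})"
        using f by simp
      then have "f \<in> range (\<lambda>c. c *\<^sub>C (\<lambda>z. if z \<in> \<Omega> then g z w else 0))"
        using assms(2) w unfolding good_rkh_module_def by blast
      ultimately show ?thesis by auto
    qed
    have "\<exists>y. V (kernel_fun \<Omega> K w \<eta>) = \<tau> (G w) y" if w: "w \<in> \<Omega>" for w \<eta>
    proof -
      have "M i (V (kernel_fun \<Omega> K w \<eta>)) = cnj (w $ i) *\<^sub>C V (kernel_fun \<Omega> K w \<eta>)" for i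
        using MV[OF K_carrier[OF w]] hlinearD(3)[OF linV K_carrier[OF w]] by (simp add: K_adj[OF w])
      then have "\<exists>y\<in>hcarrier (type_hspace :: 'f hspace). V (kernel_fun \<Omega> K w \<eta>) = \<tau> (G w) y"
        unfolding M_def
        by (intro tens.joint_eigenvector_elementary[where B = coord_mult and c = "\<lambda>i. cnj (w $ i)"]
            bg G[OF w] G_nonzero[OF w] hlinearD(1)[OF linV K_carrier[OF w]] kernel[OF w])
      then show ?thesis by blast
    qed
    \<comment> \<open>\<open>\<Psi> w \<eta>\<close> is chosen separately for each
      \<open>\<eta>\<close>; its linearity and boundedness come out only when it is identified with
      the adjoint of \<open>\<Phi> w\<close>.\<close>
    then obtain \<Psi> where \<Psi>: "\<And>w \<eta>. w \<in> \<Omega> \<Longrightarrow> V (kernel_fun \<Omega> K w \<eta>) = \<tau> (G w) (\<Psi> w \<eta>)"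
      by metis
    \<comment> \<open>\<open>G w0\<close> is the constant function 1 on \<Omega>, so
      \<open>q x\<close> is the adjoint of \<open>V\<close> applied to 1 tensored with
      \<open>x\<close>. It lies in \<open>HK\<close>, which is the source of holomorphy.\<close>
    define q where "q x = hadj HK T V (\<tau> (G w0) x)" for x
    have b\<tau>: "hbounded (type_hspace :: 'f hspace) T (\<tau> (G w0))"
      by (rule tens.hbounded_tensor_right[OF G[OF w0(1)]])
    have bq: "hbounded type_hspace HK q"
      unfolding q_def
      by (rule hbounded_compose[OF b\<tau> hbounded_hadj[OF HK.hilbert_axioms tens.T.pre_hilbert_axioms bV]
            pre_hilbert_type_hspace tens.T.pre_hilbert_axioms])
    have q: "q x \<in> hcarrier HK" for x
      using hlinearD(1)[OF hbounded_hlinear[OF bq]] by simp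
    have q_inner: "hinner HK f (q x) = hinner T (V f) (\<tau> (G w0) x)" if "f \<in> hcarrier HK" for f x
      unfolding q_def
      by (rule hinner_hadj[OF HK.hilbert_axioms tens.T.pre_hilbert_axioms bV
            tens.tensor_carrier[OF G[OF w0(1)]] that, symmetric]) simp
    have q_add: "q (x + y) = q x + q y" and q_scale: "q (c *\<^sub>C x) = c *\<^sub>C q x" for x y c
      using hlinearD(2,3)[OF hbounded_hlinear[OF bq]] by simp_all
    obtain C where C: "C \<ge> 0" "\<And>x. hnorm HK (q x) \<le> C * norm x"
      using hbounded_bound[OF bq pre_hilbert_type_hspace] by auto
    define \<Phi> where "\<Phi> z = Blinfun (\<lambda>x. q x z)" for z
    have \<Phi>: "blinfun_apply (\<Phi> z) x = q x z" for z x
    proof -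
      have bound: "norm (q x z) \<le> norm x * (C * sqrt (norm (K z z)))" for x
      proof (cases "z \<in> \<Omega>")
        case True
        have "norm (q x z) \<le> hnorm HK (q x) * sqrt (norm (K z z))"
          by (rule rkhs_eval_bound[OF RK q True])
        also have "\<dots> \<le> C * norm x * sqrt (norm (K z z))"
          by (intro mult_right_mono C(2)) simp
        finally show ?thesis by (simp only: mult_ac)
      next
        \<comment> \<open>Elements of \<open>HK\<close> vanish outside \<Omega>, so
          \<open>\<Phi> z\<close> is the zero operator there and the same bound serves every
          \<open>z\<close>.\<close>
        case False
        then show ?thesis using rkhs_outside[OF RK q] C(1) by simp
      qed
      have "bounded_linear (\<lambda>x. q x z)"
        by (rule bounded_linear_intro[OF _ _ bound])
          (simp_all add: q_add scaleR_scaleC q_scale scaleC_fun_def)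
      then show ?thesis unfolding \<Phi>_def by (simp add: bounded_linear_Blinfun_apply)
    qed
    have \<Phi>_ops: "\<Phi> z \<in> complex_ops" for z
      by (simp add: complex_ops_def \<Phi> q_scale scaleC_fun_def)
    have holo: "holo_on (\<lambda>z. blinfun_apply (\<Phi> z) x) \<Omega>" for x
      using assms(4) q unfolding \<Phi> by simp
    have "holo_on \<Phi> \<Omega>"
      by (rule holo_on_if_strongly_holo_on[OF \<open>open \<Omega>\<close> \<Phi>_ops holo])
    \<comment> \<open>Moving \<open>V\<close> across turns the pairing of q x with a kernel function
      at \<open>z\<close> into g(z, w0) <x, \<Psi>(z) \<zeta>>, and the scalar factor is 1 by the
      choice of \<open>w0\<close>.\<close>
    moreover have adj: "blinfun_apply (op_adj (\<Phi> z)) \<zeta> = \<Psi> z \<zeta>" if z: "z \<in> \<Omega>" for z \<zeta>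
    proof (rule op_adj_eqI[OF \<Phi>_ops])
      fix x
      have "cinner (q x z) \<zeta> = cnj (hinner HK (kernel_fun \<Omega> K z \<zeta>) (q x))"
        using rkhs_reproducing[OF RK q z] HK.inner_commute[OF q K_carrier[OF z]] by simp
      also have "hinner HK (kernel_fun \<Omega> K z \<zeta>) (q x) = hinner T (\<tau> (G z) (\<Psi> z \<zeta>)) (\<tau> (G w0) x)"
        using q_inner[OF K_carrier[OF z]] \<Psi>[OF z] by simp
      also have "\<dots> = hinner Hg (G z) (G w0) * cinner (\<Psi> z \<zeta>) x"
        using tens.inner_tensor[OF G[OF z] _ G[OF w0(1)]] by simp
      also have "cnj \<dots> = hinner Hg (G w0) (G z) * cinner x (\<Psi> z \<zeta>)"
        using tens.H1.inner_commute[OF G[OF w0(1)] G[OF z]] cinner_commute[of x "\<Psi> z \<zeta>"] by simp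
      finally show "cinner (blinfun_apply (\<Phi> z) x) \<zeta> = cinner x (\<Psi> z \<zeta>)"
        by (simp add: \<Phi> G_inner[OF w0(1) z] w0(2)[OF z])
    qed
    moreover have "K z w = g z w *\<^sub>C (\<Phi> z o\<^sub>L op_adj (\<Phi> w))" if z: "z \<in> \<Omega>" and w: "w \<in> \<Omega>" for z w
    proof (rule blinfun_eqI)
      fix \<eta>
      have "cinner (blinfun_apply (K z w) \<eta>) \<zeta>
          = cinner (blinfun_apply (g z w *\<^sub>C (\<Phi> z o\<^sub>L op_adj (\<Phi> w))) \<eta>) \<zeta>" for \<zeta>
      proof -
        have "cinner (blinfun_apply (K z w) \<eta>) \<zeta>
            = hinner HK (kernel_fun \<Omega> K w \<eta>) (kernel_fun \<Omega> K z \<zeta>)"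
          by (rule rkhs_inner_kernel_fun[OF RK w z, symmetric])
        also have "\<dots> = hinner T (\<tau> (G w) (\<Psi> w \<eta>)) (\<tau> (G z) (\<Psi> z \<zeta>))"
          using hisometry_inner[OF V HK.pre_hilbert_axioms tens.T.pre_hilbert_axioms K_carrier[OF w] K_carrier[OF z]]
          by (simp add: \<Psi> w z)
        also have "\<dots> = g z w * cinner (\<Psi> w \<eta>) (\<Psi> z \<zeta>)"
          using tens.inner_tensor[OF G[OF w] _ G[OF z]] G_inner[OF w z] by simp
        also have "\<dots> = g z w * cinner (blinfun_apply (\<Phi> z) (\<Psi> w \<eta>)) \<zeta>"
          by (simp add: cinner_op_adj[OF \<Phi>_ops] adj[OF z])
        finally show ?thesis
          by (simp add: scaleC_blinfun_apply cinner_scaleC_left adj[OF w])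
      qed
      then show "blinfun_apply (K z w) \<eta> = blinfun_apply (g z w *\<^sub>C (\<Phi> z o\<^sub>L op_adj (\<Phi> w))) \<eta>"
        by (rule cinner_eqI_left)
    qed
    ultimately show "\<exists>\<Phi> :: complex ^ 'n \<Rightarrow> 'f \<Rightarrow>\<^sub>L 'e.
      (\<forall>z\<in>\<Omega>. \<Phi> z \<in> complex_ops) \<and> holo_on \<Phi> \<Omega> \<and>
      (\<forall>z\<in>\<Omega>. \<forall>w\<in>\<Omega>. K z w = g z w *\<^sub>C (\<Phi> z o\<^sub>L op_adj (\<Phi> w)))"
      using \<Phi>_ops by blast
  next
    assume "\<exists>\<Phi> :: complex ^ 'n \<Rightarrow> 'f \<Rightarrow>\<^sub>L 'e.
      (\<forall>z\<in>\<Omega>. \<Phi> z \<in> complex_ops) \<and> holo_on \<Phi> \<Omega> \<and>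
      (\<forall>z\<in>\<Omega>. \<forall>w\<in>\<Omega>. K z w = g z w *\<^sub>C (\<Phi> z o\<^sub>L op_adj (\<Phi> w)))"
    then obtain \<Phi> :: "complex ^ 'n \<Rightarrow> 'f \<Rightarrow>\<^sub>L 'e" where \<Phi>: "\<And>z. z \<in> \<Omega> \<Longrightarrow> \<Phi> z \<in> complex_ops"
      and K: "\<And>z w. \<lbrakk>z \<in> \<Omega>; w \<in> \<Omega>\<rbrakk> \<Longrightarrow> K z w = g z w *\<^sub>C (\<Phi> z o\<^sub>L op_adj (\<Phi> w))"
      by blast
    let ?a = "\<lambda>(w, \<eta>). kernel_fun \<Omega> K w \<eta>"
    let ?b = "\<lambda>(w, \<eta>). \<tau> (G w) (blinfun_apply (op_adj (\<Phi> w)) \<eta>)"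
    obtain V where V: "hisometry HK T V" and V_K: "\<And>p. p \<in> \<Omega> \<times> UNIV \<Longrightarrow> V (?a p) = ?b p"
    proof (rule isometric_extension[OF HK.pre_hilbert_axioms tens.T.hilbert_axioms, of "\<Omega> \<times> UNIV" ?a ?b])
      show "?a p \<in> hcarrier HK" if "p \<in> \<Omega> \<times> UNIV" for p
        using that K_carrier by auto
      show "?b p \<in> hcarrier T" if "p \<in> \<Omega> \<times> UNIV" for p
        using that tens.tensor_carrier[OF G] by auto
      \<comment> \<open>The factorisation of \<open>K\<close> is exactly this equality of Gram
        matrices: <K(z,w) \<eta>, \<zeta>> is g(z,w) times the inner product of the adjoints of
        \<Phi>(w) and \<Phi>(z) applied to \<eta> and \<zeta>.\<close>
      show "hinner HK (?a p) (?a p') = hinner T (?b p) (?b p')"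
        if pp: "p \<in> \<Omega> \<times> UNIV" "p' \<in> \<Omega> \<times> UNIV" for p p'
      proof -
        obtain w \<eta> z \<zeta> where p: "p = (w, \<eta>)" "p' = (z, \<zeta>)" and w: "w \<in> \<Omega>" and z: "z \<in> \<Omega>"
          using pp by auto
        show ?thesis
          using tens.inner_tensor[OF G[OF w] _ G[OF z]]
          by (simp add: p rkhs_inner_kernel_fun[OF RK w z] K[OF z w] scaleC_blinfun_apply
              cinner_scaleC_left cinner_op_adj[OF \<Phi>[OF z]] G_inner[OF w z])
      qed
      have "?a ` (\<Omega> \<times> UNIV) = {kernel_fun \<Omega> K w \<eta> | w \<eta>. w \<in> \<Omega>}" by auto
      then show "hdense_span HK (?a ` (\<Omega> \<times> UNIV))" using rkhs_dense[OF RK] by simp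
    qed blast
    have linV: "hlinear HK T V" using V by (simp add: hisometry_def)
    have bV: "hbounded HK T V" by (rule hisometry_hbounded[OF V])
    \<comment> \<open>Both sides are bounded in \<open>f\<close>; on a kernel function at
      \<open>w\<close> each of them multiplies the image under \<open>V\<close> by the conjugate of
      w_i.\<close>
    have "M i (V f) = V (hadj HK HK (coord_mult i) f)" if f: "f \<in> hcarrier HK" for i f
    proof (rule hbounded_eq_on_dense[OF
          hbounded_compose[OF bV bM HK.pre_hilbert_axioms tens.T.pre_hilbert_axioms]
          hbounded_compose[OF badjK bV HK.pre_hilbert_axioms HK.pre_hilbert_axioms]
          HK.pre_hilbert_axioms tens.T.pre_hilbert_axioms rkhs_dense[OF RK] _ f])
      fix s assume "s \<in> {kernel_fun \<Omega> K w \<eta> | w \<eta>. w \<in> \<Omega>}"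
      then obtain w \<eta> where s: "s = kernel_fun \<Omega> K w \<eta>" and w: "w \<in> \<Omega>" by blast
      have Vs: "V s = \<tau> (G w) (blinfun_apply (op_adj (\<Phi> w)) \<eta>)"
        using V_K[of "(w, \<eta>)"] w by (simp add: s)
      have "M i (V s) = cnj (w $ i) *\<^sub>C V s"
        using hlinearD(3)[OF tens.linear_left G[OF w]]
        by (simp add: Vs M_tensor[OF G[OF w]] G_adj[OF w])
      also have "\<dots> = V (hadj HK HK (coord_mult i) s)"
        using hlinearD(3)[OF linV K_carrier[OF w]] by (simp add: s K_adj[OF w])
      finally show "M i (V s) = V (hadj HK HK (coord_mult i) s)" .
    qed
    then show "dilates HK Hg (type_hspace :: 'f hspace) T \<tau>"
      unfolding dilates_def M_def using V by blast
  qed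
qed

end
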